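(* Let $(M,\mathcal{H},\mathcal{V})$ be a smooth manifold with complementary foliations, with $\mathcal{H}$ transversely orientable, and let $(\phi_t)_{t\in[0,T]}$, $T\in(0,+\infty]$, be a family of diffeomorphisms of $M$ depending continuously on $t$, with $\phi_0=\mathrm{Id}$. For any fixed $x\in M$ there exists a non-decreasing sequence of times $0=s_0<s_1<s_2<\cdots<s_r=s_{r+1}=\cdots=T$, with $r\in\mathbb{N}\cup\{\infty\}$, such that for all $t\in[0,T]$ there exists a neighbourhood $U_x$ of $x$ where the following foliated decomposition holds: if $t\in[s_{k-1},s_k]$, then on $U_x$ $$\phi_t=(\eta^k_t\circ\psi^k_t)\circ\cdots\circ(\eta^2_{s_2}\circ\psi^2_{s_2})\circ(\eta^1_{s_1}\circ\psi^1_{s_1}),$$ with $\eta^k_{s_{k-1}}=\mathrm{Id}$ and $\psi^k_{s_{k-1}}=\mathrm{Id}$, where $\eta^j$ and $\psi^j$ are horizontal and vertical (local) diffeomorphisms respectively, for all $j=1,\dots,k$.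
   Context: Foliations $\mathcal{H}$ (horizontal) and $\mathcal{V}$ (vertical) of $M$ are complementary if at each point the tangent space of $M$ is the direct sum of the tangent spaces of the two leaves through it. A biregular atlas on $(M,\mathcal{H},\mathcal{V})$ consists of charts $\alpha:U\to U_1\times U_2\subset\mathbb{R}^{q}\times\mathbb{R}^{n-q}$, foliated for both foliations, with horizontal plaques $\{y=\text{const}\}$, vertical plaques $\{x=\text{const}\}$, and coordinate changes of the form $(x,y)\mapsto(h_1(x),h_2(y))$. $\mathcal{H}$ is transversely orientable if charts can be chosen so that the transverse coordinate changes have positive Jacobian determinant, $\det Dh_2>0$. A (local) diffeomorphism is horizontal (resp. vertical) if it maps each point to a point of the same leaf of $\mathcal{H}$ (resp. $\mathcal{V}$). Continuity in $t$ means continuity as a curve in the group of diffeomorphisms, i.e. $\phi_t$ and its derivatives depend continuously on $t$ uniformly on compact sets. When $T=+\infty$, $[0,T]$ is read as $[0,\infty)$; when $r=\infty$, $s_r=T$ is read as $s_k\to T$. *)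

theory Defs
  imports "HOL-Analysis.Analysis"
begin

section \<open>Smooth maps between Euclidean spaces\<close>

text \<open>
  \<open>iter_deriv [v\<^sub>1, \<dots>, v\<^sub>m] f\<close> is the iterated directional derivative of \<open>f\<close>. On an open set,
  \<open>f\<close> is smooth iff all of these exist and are (Frechet) differentiable;
  \<open>smooth_on\<close> is only used for open sets.
\<close>

primrec iter_deriv ::
  "'e::euclidean_space list \<Rightarrow> ('e \<Rightarrow> 'f::euclidean_space) \<Rightarrow> 'e \<Rightarrow> 'f" where
  "iter_deriv [] f = f"
| "iter_deriv (v # vs) f = (\<lambda>z. frechet_derivative (iter_deriv vs f) (at z) v)"

definition smooth_on ::
  "'e::euclidean_space set \<Rightarrow> ('e \<Rightarrow> 'f::euclidean_space) \<Rightarrow> bool" where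
  "smooth_on S f \<longleftrightarrow> (\<forall>vs. \<forall>z\<in>S. iter_deriv vs f differentiable (at z))"

section \<open>Smooth manifolds\<close>

text \<open>
  A chart is a pair of an open domain and a coordinate map, whose values outside the domain are
  irrelevant. The manifold is the whole type \<open>'a\<close>, a second countable Hausdorff space.
\<close>

type_synonym ('a, 'e) chart = "'a set \<times> ('a \<Rightarrow> 'e)"

definition is_chart ::
  "('a::topological_space, 'e::euclidean_space) chart \<Rightarrow> bool" where
  "is_chart = (\<lambda>(U, \<alpha>). open U \<and> open (\<alpha> ` U) \<and> homeomorphism U (\<alpha> ` U) \<alpha> (inv_into U \<alpha>))"

definition smooth_atlas ::
  "('a::topological_space, 'e::euclidean_space) chart set \<Rightarrow> bool" where
  "smooth_atlas A \<longleftrightarrow>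
     (\<forall>c\<in>A. is_chart c) \<and> (\<Union>c\<in>A. fst c) = UNIV \<and>
     (\<forall>(U, \<alpha>)\<in>A. \<forall>(W, \<beta>)\<in>A. smooth_on (\<alpha> ` (U \<inter> W)) (\<beta> \<circ> inv_into U \<alpha>))"

definition smooth_map_on ::
  "('a::topological_space, 'e::euclidean_space) chart set \<Rightarrow> 'a set \<Rightarrow> ('a \<Rightarrow> 'a) \<Rightarrow> bool" where
  "smooth_map_on A D f \<longleftrightarrow> continuous_on D f \<and>
     (\<forall>(U, \<alpha>)\<in>A. \<forall>(W, \<beta>)\<in>A. smooth_on (\<alpha> ` (U \<inter> D \<inter> f -` W)) (\<beta> \<circ> f \<circ> inv_into U \<alpha>))"

definition diffeo_on ::
  "('a::topological_space, 'e::euclidean_space) chart set \<Rightarrow> 'a set \<Rightarrow> ('a \<Rightarrow> 'a) \<Rightarrow> bool" where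
  "diffeo_on A D f \<longleftrightarrow> open D \<and> open (f ` D) \<and> inj_on f D \<and>
     smooth_map_on A D f \<and> smooth_map_on A (f ` D) (inv_into D f)"

definition diffeo ::
  "('a::topological_space, 'e::euclidean_space) chart set \<Rightarrow> ('a \<Rightarrow> 'a) \<Rightarrow> bool" where
  "diffeo A f \<longleftrightarrow> surj f \<and> diffeo_on A UNIV f"

text \<open>
  Local diffeomorphisms are partial maps, i.e. diffeomorphisms between open subsets; in this way
  composition with \<open>\<circ>\<^sub>m\<close> keeps track of the domains.
\<close>

definition local_diffeo ::
  "('a::topological_space, 'e::euclidean_space) chart set \<Rightarrow> ('a \<rightharpoonup> 'a) \<Rightarrow> bool" where
  "local_diffeo A f \<longleftrightarrow> diffeo_on A (dom f) (\<lambda>z. the (f z))"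

text \<open>
  Continuity of a curve of diffeomorphisms for the \<open>C\<^sup>\<infinity>\<close> compact-open topology: in charts, the
  maps and all their derivatives converge uniformly on compact sets.
\<close>

definition smoothly_continuous_on ::
  "('a::topological_space, 'e::euclidean_space) chart set \<Rightarrow> real set \<Rightarrow> (real \<Rightarrow> 'a \<Rightarrow> 'a) \<Rightarrow> bool"
where
  "smoothly_continuous_on A I \<phi> \<longleftrightarrow>
     (\<forall>(U, \<alpha>)\<in>A. \<forall>(W, \<beta>)\<in>A. \<forall>K. \<forall>t\<^sub>0\<in>I. compact K \<and> K \<subseteq> U \<and> \<phi> t\<^sub>0 ` K \<subseteq> W \<longrightarrow>
        (\<forall>\<^sub>F t in at t\<^sub>0 within I. \<phi> t ` K \<subseteq> W) \<and>
        (\<forall>vs. uniform_limit (\<alpha> ` K)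
           (\<lambda>t. iter_deriv vs (\<beta> \<circ> \<phi> t \<circ> inv_into U \<alpha>))
           (iter_deriv vs (\<beta> \<circ> \<phi> t\<^sub>0 \<circ> inv_into U \<alpha>))
           (at t\<^sub>0 within I)))"

section \<open>Foliations\<close>

text \<open>
  A foliation is given by an atlas of foliated charts onto products of connected open sets.
  The projection \<open>\<tau>\<close> to the transverse factor is \<open>snd\<close> for horizontal foliations (the plaques are
  \<open>y = const\<close>) and \<open>fst\<close> for vertical ones (the plaques are \<open>x = const\<close>).
  Since the overlap of two charts may contain several pieces of the same plaque, the transverse
  coordinate change \<open>h\<close> is only defined locally, near a point \<open>p\<close> of the overlap.
\<close>

definition transverse_change ::
  "('e \<Rightarrow> 'c) \<Rightarrow> ('a::topological_space, 'e) chart \<Rightarrow> ('a, 'e) chart \<Rightarrow> 'a \<Rightarrow> ('c \<Rightarrow> 'c) \<Rightarrow> bool"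
where
  "transverse_change \<tau> c d p h \<longleftrightarrow>
     (\<exists>N. open N \<and> p \<in> N \<and> N \<subseteq> fst c \<inter> fst d \<and> (\<forall>z\<in>N. \<tau> (snd d z) = h (\<tau> (snd c z))))"

definition foliation ::
  "('a::topological_space, 'x::euclidean_space \<times> 'y::euclidean_space) chart set \<Rightarrow>
   ('x \<times> 'y \<Rightarrow> 'c) \<Rightarrow> ('a, 'x \<times> 'y) chart set \<Rightarrow> bool" where
  "foliation A \<tau> F \<longleftrightarrow>
     smooth_atlas (A \<union> F) \<and> (\<Union>c\<in>F. fst c) = UNIV \<and>
     (\<forall>(U, \<alpha>)\<in>F. \<exists>X Y. open X \<and> connected X \<and> open Y \<and> connected Y \<and> \<alpha> ` U = X \<times> Y) \<and>
     (\<forall>c\<in>F. \<forall>d\<in>F. \<forall>p \<in> fst c \<inter> fst d. \<exists>h. transverse_change \<tau> c d p h)"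

text \<open>Leaves are the equivalence classes generated by lying in a common plaque.\<close>

definition same_plaque :: "('e \<Rightarrow> 'c) \<Rightarrow> ('a, 'e) chart set \<Rightarrow> 'a \<Rightarrow> 'a \<Rightarrow> bool" where
  "same_plaque \<tau> F p q \<longleftrightarrow> (\<exists>(U, \<alpha>)\<in>F. p \<in> U \<and> q \<in> U \<and> \<tau> (\<alpha> p) = \<tau> (\<alpha> q))"

definition leaf :: "('e \<Rightarrow> 'c) \<Rightarrow> ('a, 'e) chart set \<Rightarrow> 'a \<Rightarrow> 'a set" where
  "leaf \<tau> F p = {q. (same_plaque \<tau> F)\<^sup>*\<^sup>* p q}"

text \<open>
  The tangent space at \<open>p\<close> of the leaf through \<open>p\<close>, read in the coordinates of a chart \<open>\<gamma>\<close> around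
  \<open>p\<close>. All foliated charts around \<open>p\<close> give the same subspace.
\<close>

definition leaf_tangent ::
  "('e::euclidean_space \<Rightarrow> 'c::zero) \<Rightarrow> ('a, 'e) chart set \<Rightarrow> ('a \<Rightarrow> 'e) \<Rightarrow> 'a \<Rightarrow> 'e set" where
  "leaf_tangent \<tau> F \<gamma> p =
     {frechet_derivative (\<gamma> \<circ> inv_into U \<alpha>) (at (\<alpha> p)) u | U \<alpha> u. (U, \<alpha>) \<in> F \<and> p \<in> U \<and> \<tau> u = 0}"

definition complementary ::
  "('a, 'x::euclidean_space \<times> 'y::euclidean_space) chart set \<Rightarrow>
   ('a, 'x \<times> 'y) chart set \<Rightarrow> ('a, 'x \<times> 'y) chart set \<Rightarrow> bool" where
  "complementary A H V \<longleftrightarrow>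
     (\<forall>(W, \<gamma>)\<in>A. \<forall>p\<in>W.
        {u + v | u v. u \<in> leaf_tangent snd H \<gamma> p \<and> v \<in> leaf_tangent fst V \<gamma> p} = UNIV \<and>
        leaf_tangent snd H \<gamma> p \<inter> leaf_tangent fst V \<gamma> p = {0})"

text \<open>
  The second condition below says that the foliated atlas \<open>F\<close> defines the same foliation as \<open>H\<close>.
\<close>

definition transversely_orientable ::
  "('a::topological_space, 'x::euclidean_space \<times> (real ^ 'p)) chart set \<Rightarrow>
   ('a, 'x \<times> (real ^ 'p)) chart set \<Rightarrow> bool" where
  "transversely_orientable A H \<longleftrightarrow>
     (\<exists>F. foliation A snd F \<and> foliation A snd (H \<union> F) \<and>
        (\<forall>c\<in>F. \<forall>d\<in>F. \<forall>p \<in> fst c \<inter> fst d. \<exists>h. transverse_change snd c d p h \<and>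
           det (matrix (frechet_derivative h (at (snd (snd c p))))) > 0))"

definition horizontal ::
  "('a, 'x \<times> 'y) chart set \<Rightarrow> ('a \<rightharpoonup> 'a) \<Rightarrow> bool" where
  "horizontal H f \<longleftrightarrow> (\<forall>p q. f p = Some q \<longrightarrow> q \<in> leaf snd H p)"

definition vertical ::
  "('a, 'x \<times> 'y) chart set \<Rightarrow> ('a \<rightharpoonup> 'a) \<Rightarrow> bool" where
  "vertical V f \<longleftrightarrow> (\<forall>p q. f p = Some q \<longrightarrow> q \<in> leaf fst V p)"

section \<open>Foliated decompositions\<close>

text \<open>The interval \<open>[0, T]\<close>, read as \<open>[0, \<infinity>)\<close> if \<open>T = \<infinity>\<close>.\<close>

definition time_interval :: "ereal \<Rightarrow> real set" where
  "time_interval T = {t. 0 \<le> t \<and> ereal t \<le> T}"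

definition time_partition :: "ereal \<Rightarrow> enat \<Rightarrow> (nat \<Rightarrow> ereal) \<Rightarrow> bool" where
  "time_partition T r s \<longleftrightarrow>
     s 0 = 0 \<and> (\<forall>k. enat k < r \<longrightarrow> s k < s (Suc k)) \<and> (\<forall>k. r \<le> enat k \<longrightarrow> s k = T) \<and>
     (r = \<infinity> \<longrightarrow> s \<longlonglongrightarrow> T)"

text \<open>
  \<open>foliated_chain s \<eta> \<psi> k\<close> is the partial map
  \<open>(\<eta>\<^sup>k\<^sub>t \<circ> \<psi>\<^sup>k\<^sub>t) \<circ> \<dots> \<circ> (\<eta>\<^sup>1\<^sub>t \<circ> \<psi>\<^sup>1\<^sub>t)\<close> with the \<open>j\<close>-th factor taken at time \<open>t = s\<^sub>j\<close>. It is only used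
  when \<open>s k\<close> is finite.
\<close>

primrec foliated_chain ::
  "(nat \<Rightarrow> ereal) \<Rightarrow> (nat \<Rightarrow> real \<Rightarrow> 'a \<rightharpoonup> 'a) \<Rightarrow> (nat \<Rightarrow> real \<Rightarrow> 'a \<rightharpoonup> 'a) \<Rightarrow> nat \<Rightarrow> 'a \<rightharpoonup> 'a" where
  "foliated_chain s \<eta> \<psi> 0 = Some"
| "foliated_chain s \<eta> \<psi> (Suc k) =
     (\<eta> (Suc k) (real_of_ereal (s (Suc k))) \<circ>\<^sub>m \<psi> (Suc k) (real_of_ereal (s (Suc k))))
       \<circ>\<^sub>m foliated_chain s \<eta> \<psi> k"

end

theory Submission
  imports Defs
begin

text \<open>
  Around any point there is a biregular chart: its first coordinates are constant on vertical
  plaques, its second coordinates are constant on horizontal plaques (lemma \<open>biregular_chart\<close>).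
  In such a chart, a map \<open>(x, y) \<mapsto> (f(x, y), g(x, y))\<close> that is \<open>C\<^sup>1\<close>-close to the identity is the
  vertical map \<open>(x, y) \<mapsto> (x, g(x, y))\<close> followed by a horizontal one; the first is a local
  diffeomorphism since its differential is close to the identity. Applied to the transition from
  \<open>\<phi>\<^sub>s\<close> to \<open>\<phi>\<^sub>t\<close> near the point \<open>\<phi>\<^sub>s(x)\<close>, this decomposes the transition for all \<open>s\<close> and \<open>t\<close> close
  to a given time (lemmas \<open>foliated_step_exists\<close> and \<open>foliated_step_nearby\<close>).

  By compactness, \<open>[0, T]\<close> is cut into finitely many intervals, or \<open>[0, \<infinity>)\<close> into a locally finite
  sequence of intervals, such that the decomposition applies between the left end point of an
  interval and every time in it (lemma \<open>time_partition_exists\<close>). Composing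
  the transitions from \<open>\<phi>\<^sub>0 = id\<close> on gives the theorem. The neighbourhood of \<open>x\<close> is the intersection
  of those of the finitely many nontrivial transitions before time \<open>t\<close>.

  The analytic input is the inverse function theorem for smooth maps: it turns a smooth map to
  the model space with injective differential into a chart
  (lemma \<open>compatible_chart_of_injective_derivative\<close>), and both the biregular chart and the
  intermediate map of the decomposition arise in this way.
\<close>

section \<open>Calculus of smooth maps between Euclidean spaces\<close>

text \<open>
  Smoothness is the conjunction of these predicates over all \<open>k\<close>. The closure properties below are
  proved for a fixed \<open>k\<close>, because they are inductions on \<open>k\<close>: the derivative of a composite, of a
  product or of an inverse is built from the same functions and from derivatives of one order less.
\<close>

definition diff_upto ::
  "nat \<Rightarrow> 'e::euclidean_space set \<Rightarrow> ('e \<Rightarrow> 'f::euclidean_space) \<Rightarrow> bool" where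
  "diff_upto k S f \<longleftrightarrow>
     (\<forall>vs. length vs \<le> k \<longrightarrow> (\<forall>z\<in>S. iter_deriv vs f differentiable (at z)))"

lemma smooth_on_iff_diff_upto: "smooth_on S f \<longleftrightarrow> (\<forall>k. diff_upto k S f)"
  unfolding smooth_on_def diff_upto_def by blast

lemma iter_deriv_snoc:
  "iter_deriv (vs @ [v]) f = iter_deriv vs (\<lambda>z. frechet_derivative f (at z) v)"
  by (induction vs) auto

lemma diff_upto_0: "diff_upto 0 S f \<longleftrightarrow> (\<forall>z\<in>S. f differentiable (at z))"
  by (simp add: diff_upto_def)

text \<open>
  \<open>iter_deriv\<close> adds the last derivative at the head of the list, whereas inductions on \<open>k\<close> peel off
  the first derivative taken, which sits at the end. This recursion is the form that they use.
\<close>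

lemma diff_upto_Suc:
  "diff_upto (Suc k) S f \<longleftrightarrow>
     (\<forall>z\<in>S. f differentiable (at z)) \<and>
     (\<forall>v. diff_upto k S (\<lambda>z. frechet_derivative f (at z) v))" (is "?L \<longleftrightarrow> ?R")
proof
  assume L: ?L
  show ?R
  proof (intro conjI allI)
    show "\<forall>z\<in>S. f differentiable (at z)"
      using L[unfolded diff_upto_def, rule_format, of "[]"] by simp
    show "diff_upto k S (\<lambda>z. frechet_derivative f (at z) v)" for v
      unfolding diff_upto_def iter_deriv_snoc[symmetric]
      using L unfolding diff_upto_def by (metis Suc_le_mono length_append_singleton)
  qed
next
  assume R: ?R
  show ?L
    unfolding diff_upto_def
  proof (intro allI impI)
    fix vs :: "'a list" assume len: "length vs \<le> Suc k"
    show "\<forall>z\<in>S. iter_deriv vs f differentiable (at z)"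
    proof (cases vs rule: rev_cases)
      case Nil
      then show ?thesis using R by simp
    next
      case (snoc ws v)
      then show ?thesis using R len by (simp add: iter_deriv_snoc diff_upto_def)
    qed
  qed
qed

lemma diff_upto_SucD: "diff_upto (Suc k) S f \<Longrightarrow> diff_upto k S f"
  by (simp add: diff_upto_def)

lemma diff_upto_differentiable: "diff_upto k S f \<Longrightarrow> z \<in> S \<Longrightarrow> f differentiable (at z)"
  by (induction k) (auto simp: diff_upto_0 diff_upto_Suc)

lemma iter_deriv_cong:
  assumes "open S" "\<forall>z\<in>S. f z = g z" "diff_upto k S f" "length vs \<le> k" "z \<in> S"
  shows "iter_deriv vs g z = iter_deriv vs f z"
  using assms(4,5)
proof (induction vs arbitrary: z)
  case Nil
  then show ?case using assms by simp
next
  case (Cons v vs)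
  have "iter_deriv vs f differentiable (at z)"
    using assms(3) Cons.prems unfolding diff_upto_def by simp
  then have "frechet_derivative (iter_deriv vs f) (at z) = frechet_derivative (iter_deriv vs g) (at z)"
    by (rule frechet_derivative_transform_within_open[OF _ assms(1) Cons.prems(2)])
      (use Cons in auto)
  then show ?case by simp
qed

lemma diff_upto_cong:
  assumes "open S" "\<And>z. z \<in> S \<Longrightarrow> f z = g z" "diff_upto k S f"
  shows "diff_upto k S g"
  unfolding diff_upto_def
proof (intro allI impI ballI)
  fix vs :: "'a list" and z assume "length vs \<le> k" "z \<in> S"
  then have "iter_deriv vs f differentiable (at z)" using assms(3) by (simp add: diff_upto_def)
  then obtain D where D: "(iter_deriv vs f has_derivative D) (at z)" unfolding differentiable_def by blast
  have "iter_deriv vs g y = iter_deriv vs f y" if "y \<in> S" for y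
    by (rule iter_deriv_cong[OF assms(1) _ assms(3) \<open>length vs \<le> k\<close> that]) (simp add: assms(2))
  then have "(iter_deriv vs g has_derivative D) (at z)"
    by (intro has_derivative_transform_within_open[OF D assms(1) \<open>z \<in> S\<close>]) simp
  then show "iter_deriv vs g differentiable (at z)" unfolding differentiable_def by blast
qed

text \<open>
  The working form of the recursion: it suffices to exhibit any formula for the derivative on the
  open set, since \<open>frechet_derivative\<close> then agrees with it.
\<close>

lemma diff_upto_SucI:
  assumes "open S" "\<And>z. z \<in> S \<Longrightarrow> (f has_derivative f' z) (at z)"
    and "\<And>v. diff_upto k S (\<lambda>z. f' z v)"
  shows "diff_upto (Suc k) S f"
  unfolding diff_upto_Suc
proof (intro conjI ballI allI)
  show "f differentiable (at z)" if "z \<in> S" for z using assms(2) that by (auto simp: differentiable_def)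
  show "diff_upto k S (\<lambda>z. frechet_derivative f (at z) v)" for v
    by (rule diff_upto_cong[OF assms(1) _ assms(3)[of v]])
      (simp add: frechet_derivative_at[OF assms(2), symmetric])
qed

lemma diff_upto_has_derivative:
  "diff_upto k S f \<Longrightarrow> z \<in> S \<Longrightarrow> (f has_derivative frechet_derivative f (at z)) (at z)"
  using diff_upto_differentiable frechet_derivative_works by blast

lemma diff_upto_const: "diff_upto k S (\<lambda>z. c)"
  by (induction k arbitrary: c) (simp_all add: diff_upto_0 diff_upto_Suc)

lemma diff_upto_linear:
  assumes S: "open S" and L: "bounded_linear L"
  shows "diff_upto k S f \<Longrightarrow> diff_upto k S (\<lambda>z. L (f z))"
proof (induction k arbitrary: f)
  case 0
  then show ?case
    unfolding diff_upto_0 differentiable_def using bounded_linear.has_derivative[OF L] by blast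
next
  case (Suc k)
  show ?case
  proof (rule diff_upto_SucI[OF S])
    show "((\<lambda>z. L (f z)) has_derivative (\<lambda>v. L (frechet_derivative f (at z) v))) (at z)" if "z \<in> S" for z
      using bounded_linear.has_derivative[OF L] diff_upto_has_derivative[OF Suc.prems that] by blast
    show "diff_upto k S (\<lambda>z. L (frechet_derivative f (at z) v))" for v
      using Suc by (simp add: diff_upto_Suc)
  qed
qed

lemma diff_upto_add:
  assumes S: "open S"
  shows "diff_upto k S f \<Longrightarrow> diff_upto k S g \<Longrightarrow> diff_upto k S (\<lambda>z. f z + g z)"
proof (induction k arbitrary: f g)
  case (Suc k)
  show ?case
    by (rule diff_upto_SucI[OF S has_derivative_add[OF diff_upto_has_derivative diff_upto_has_derivative,
          OF Suc.prems(1) _ Suc.prems(2)]])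
      (use Suc in \<open>auto simp: diff_upto_Suc\<close>)
qed (simp add: diff_upto_0)

lemma diff_upto_sum:
  assumes S: "open S"
  shows "(\<And>i. i \<in> I \<Longrightarrow> diff_upto k S (f i)) \<Longrightarrow> diff_upto k S (\<lambda>z. \<Sum>i\<in>I. f i z)"
  by (induction I rule: infinite_finite_induct) (auto intro: diff_upto_const diff_upto_add[OF S])

lemma diff_upto_scaleR:
  fixes c :: "'e::euclidean_space \<Rightarrow> real"
  assumes S: "open S"
  shows "diff_upto k S c \<Longrightarrow> diff_upto k S f \<Longrightarrow> diff_upto k S (\<lambda>z. c z *\<^sub>R f z)"
proof (induction k arbitrary: c f)
  case (Suc k)
  let ?c' = "\<lambda>z. frechet_derivative c (at z)" and ?f' = "\<lambda>z. frechet_derivative f (at z)"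
  show ?case
  proof (rule diff_upto_SucI[OF S])
    show "((\<lambda>z. c z *\<^sub>R f z) has_derivative (\<lambda>v. c z *\<^sub>R ?f' z v + ?c' z v *\<^sub>R f z)) (at z)"
      if "z \<in> S" for z
      by (rule has_derivative_scaleR[OF diff_upto_has_derivative[OF Suc.prems(1) that]
            diff_upto_has_derivative[OF Suc.prems(2) that]])
    have "diff_upto k S c" "diff_upto k S f" using Suc.prems diff_upto_SucD by blast+
    moreover have "diff_upto k S (\<lambda>z. ?c' z v)" "diff_upto k S (\<lambda>z. ?f' z v)" for v
      using Suc.prems by (simp_all add: diff_upto_Suc)
    ultimately show "diff_upto k S (\<lambda>z. c z *\<^sub>R ?f' z v + ?c' z v *\<^sub>R f z)" for v
      by (intro diff_upto_add[OF S] Suc.IH)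
  qed
qed (simp add: diff_upto_0)

lemma diff_upto_inner:
  assumes "open S" "diff_upto k S f"
  shows "diff_upto k S (\<lambda>z. f z \<bullet> b)"
  by (rule diff_upto_linear[OF assms(1) bounded_linear_inner_left assms(2)])

lemma linear_eq_sum_Basis:
  fixes u :: "'e::euclidean_space"
  assumes "linear L"
  shows "L u = (\<Sum>b\<in>Basis. (u \<bullet> b) *\<^sub>R L b)"
  using linear_sum[OF assms, of "\<lambda>b. (u \<bullet> b) *\<^sub>R b" Basis] linear_cmul[OF assms]
  by (simp add: euclidean_representation)

text \<open>
  The chain rule has to be expanded in the basis: \<open>Dg(f z)(Df(z) v)\<close> is the sum over the basis
  vectors \<open>b\<close> of \<open>(Df(z) v \<bullet> b) D\<^sub>b g(f z)\<close>, in which only composites of directional derivatives of \<open>g\<close>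
  with \<open>f\<close> appear, and to those the induction hypothesis applies.
\<close>

lemma diff_upto_compose:
  assumes S: "open S" and T: "open T" and ST: "f ` S \<subseteq> T"
  shows "diff_upto k S f \<Longrightarrow> diff_upto k T g \<Longrightarrow> diff_upto k S (g \<circ> f)"
proof (induction k arbitrary: g)
  case 0
  then show ?case using ST unfolding diff_upto_0 by (metis differentiable_chain_at image_subset_iff)
next
  case (Suc k)
  let ?f' = "\<lambda>z. frechet_derivative f (at z)" and ?g' = "\<lambda>y. frechet_derivative g (at y)"
  have "(g \<circ> f has_derivative (\<lambda>v. \<Sum>b\<in>Basis. (?f' z v \<bullet> b) *\<^sub>R ?g' (f z) b)) (at z)"
    if "z \<in> S" for z
  proof -
    have f: "(f has_derivative ?f' z) (at z)"
      using diff_upto_has_derivative[OF Suc.prems(1) that] .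
    have g: "(g has_derivative ?g' (f z)) (at (f z))"
      using diff_upto_has_derivative[OF Suc.prems(2)] ST that by blast
    have "?g' (f z) \<circ> ?f' z = (\<lambda>v. \<Sum>b\<in>Basis. (?f' z v \<bullet> b) *\<^sub>R ?g' (f z) b)"
      unfolding o_def by (intro ext linear_eq_sum_Basis[OF has_derivative_linear[OF g]])
    then show ?thesis using diff_chain_at[OF f g] by simp
  qed
  moreover have "diff_upto k S (\<lambda>z. \<Sum>b\<in>Basis. (?f' z v \<bullet> b) *\<^sub>R ?g' (f z) b)" for v
  proof -
    have "diff_upto k S (\<lambda>z. ?g' (f z) b)" for b
      using Suc.IH[OF diff_upto_SucD[OF Suc.prems(1)], of "\<lambda>y. ?g' y b"] Suc.prems(2)
      by (simp add: diff_upto_Suc o_def)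
    moreover have "diff_upto k S (\<lambda>z. ?f' z v)"
      using Suc.prems(1) by (simp add: diff_upto_Suc)
    ultimately show ?thesis
      by (intro diff_upto_sum[OF S] diff_upto_scaleR[OF S] diff_upto_inner[OF S])
  qed
  ultimately show ?case by (rule diff_upto_SucI[OF S])
qed

text \<open>
  The classical formula \<open>(M\<^sup>-\<^sup>1)' = - M\<^sup>-\<^sup>1 M' M\<^sup>-\<^sup>1\<close>, written in coordinates. Differentiability of the
  pointwise inverse \<open>N\<close> is the point, as not even its continuity is given. It
  comes from the map \<open>F(y, u) = (y, M(y) u)\<close>, whose derivative is invertible and whose inverse is
  \<open>G(y, v) = (y, N(y) v)\<close>: an inverse of a differentiable map with invertible derivative is
  differentiable.
\<close>

lemma has_derivative_inverse_operator:
  fixes M N :: "'s::euclidean_space \<Rightarrow> 'e::euclidean_space \<Rightarrow> 'e"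
  assumes S: "open S" and y: "y \<in> S"
    and M: "\<And>z. z \<in> S \<Longrightarrow> linear (M z)" and N: "\<And>z. z \<in> S \<Longrightarrow> linear (N z)"
    and NM: "\<And>z u. z \<in> S \<Longrightarrow> N z (M z u) = u" and MN: "\<And>z u. z \<in> S \<Longrightarrow> M z (N z u) = u"
    and d: "\<And>z c. z \<in> S \<Longrightarrow> ((\<lambda>z. M z c) has_derivative M' z c) (at z)"
  shows "((\<lambda>z. N z v) has_derivative
           (\<lambda>h. - (\<Sum>b\<in>Basis. (\<Sum>c\<in>Basis. (N y v \<bullet> c) * (M' y c h \<bullet> b)) *\<^sub>R N y b))) (at y)"
proof -
  \<comment> \<open>The sum expands \<open>M(y) u\<close> in the basis: only \<open>z \<mapsto> M z c\<close> for fixed \<open>c\<close> is known to be differentiable.\<close>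
  define F where "F = (\<lambda>p. (fst p, \<Sum>c\<in>Basis. (snd p \<bullet> c) *\<^sub>R M (fst p) c))"
  define G where "G = (\<lambda>p. (fst p, N (fst p) (snd p)))"
  define u where "u = N y v"
  define Q where "Q = (\<lambda>h. \<Sum>c\<in>Basis. (u \<bullet> c) *\<^sub>R M' y c h)"
  have F: "F p = (fst p, M (fst p) (snd p))" if "fst p \<in> S" for p
    using linear_eq_sum_Basis[OF M[OF that]] unfolding F_def by metis
  have dF: "(F has_derivative (\<lambda>p. (fst p, \<Sum>c\<in>Basis. (snd q \<bullet> c) *\<^sub>R M' (fst q) c (fst p)
                + (snd p \<bullet> c) *\<^sub>R M (fst q) c))) (at q)" if "fst q \<in> S" for q
  proof -
    have "((\<lambda>p. (snd p \<bullet> c) *\<^sub>R M (fst p) c) has_derivative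
      (\<lambda>p. (snd q \<bullet> c) *\<^sub>R M' (fst q) c (fst p) + (snd p \<bullet> c) *\<^sub>R M (fst q) c)) (at q)" for c
      by (intro has_derivative_scaleR has_derivative_inner_left has_derivative_snd has_derivative_ident
           has_derivative_compose[OF has_derivative_fst[OF has_derivative_ident] d[OF that]])
    then show ?thesis unfolding F_def
      by (intro has_derivative_Pair has_derivative_fst has_derivative_ident has_derivative_sum)
  qed
  have op: "open (S \<times> (UNIV::'e set))" using S by (simp add: open_Times)
  have "(G has_derivative (\<lambda>p. (fst p, N y (snd p - Q (fst p))))) (at (F (y, u)))"
  proof (rule has_derivative_inverse_strong[OF op, where f = F and x = "(y, u)"])
    show "(y, u) \<in> S \<times> UNIV" using y by simp
    show "continuous_on (S \<times> UNIV) F"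
      by (rule continuous_at_imp_continuous_on) (auto intro: has_derivative_continuous[OF dF])
    show "G (F p) = p" if "p \<in> S \<times> UNIV" for p
      using that F[of p] NM by (auto simp: G_def)
    show "(F has_derivative (\<lambda>p. (fst p, Q (fst p) + M y (snd p)))) (at (y, u))"
      using dF[of "(y,u)"] y
      by (simp add: Q_def sum.distrib linear_eq_sum_Basis[OF M[OF y], symmetric])
    show "(\<lambda>p. (fst p, Q (fst p) + M y (snd p))) \<circ> (\<lambda>p. (fst p, N y (snd p - Q (fst p)))) = id"
      using MN[OF y] by auto
  qed
  moreover have "F (y, u) = (y, v)" using F[of "(y,u)"] y MN by (simp add: u_def)
  ultimately have dG: "(G has_derivative (\<lambda>p. (fst p, N y (snd p - Q (fst p))))) (at (y, v))" by simp
  have "((\<lambda>z. (z, v)) has_derivative (\<lambda>h. (h, 0))) (at y)"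
    by (intro derivative_eq_intros) auto
  from has_derivative_snd[OF has_derivative_compose[OF this dG]]
  have "((\<lambda>z. N z v) has_derivative (\<lambda>h. N y (- Q h))) (at y)"
    by (simp add: G_def)
  moreover have "N y (- Q h) = - (\<Sum>b\<in>Basis. (\<Sum>c\<in>Basis. (N y v \<bullet> c) * (M' y c h \<bullet> b)) *\<^sub>R N y b)" for h
  proof -
    have "N y (- Q h) = - N y (Q h)" using linear_neg[OF N[OF y]] by simp
    also have "N y (Q h) = (\<Sum>b\<in>Basis. (Q h \<bullet> b) *\<^sub>R N y b)" by (rule linear_eq_sum_Basis[OF N[OF y]])
    finally show ?thesis by (simp add: Q_def u_def inner_sum_left)
  qed
  ultimately show ?thesis by simp
qed

text \<open>
  By the preceding formula, the derivative of \<open>N\<close> is polynomial in \<open>N\<close> and in the derivative of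
  \<open>M\<close>, so \<open>N\<close> gains one order of differentiability in each step of the induction.
\<close>

lemma diff_upto_inverse_operator:
  fixes M N :: "'s::euclidean_space \<Rightarrow> 'e::euclidean_space \<Rightarrow> 'e"
  assumes S: "open S"
    and M: "\<And>z. z \<in> S \<Longrightarrow> linear (M z)" and N: "\<And>z. z \<in> S \<Longrightarrow> linear (N z)"
    and NM: "\<And>z u. z \<in> S \<Longrightarrow> N z (M z u) = u" and MN: "\<And>z u. z \<in> S \<Longrightarrow> M z (N z u) = u"
  shows "(\<And>c. diff_upto k S (\<lambda>z. M z c)) \<Longrightarrow> diff_upto k S (\<lambda>z. N z v)"
proof (induction k arbitrary: v)
  case 0
  then have "((\<lambda>z. M z c) has_derivative frechet_derivative (\<lambda>z. M z c) (at z)) (at z)" if "z \<in> S" for z c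
    using diff_upto_has_derivative that by blast
  from has_derivative_inverse_operator[OF S _ M N NM MN this]
  show ?case unfolding diff_upto_0 differentiable_def by blast
next
  case (Suc k)
  let ?M' = "\<lambda>z c. frechet_derivative (\<lambda>z. M z c) (at z)"
  have IH: "diff_upto k S (\<lambda>z. N z v)" for v
    using Suc diff_upto_SucD by blast
  have M': "diff_upto k S (\<lambda>z. ?M' z c h)" for c h using Suc.prems by (simp add: diff_upto_Suc)
  have d: "((\<lambda>z. M z c) has_derivative ?M' z c) (at z)" if "z \<in> S" for z c
    using diff_upto_has_derivative[OF Suc.prems that] .
  have "((\<lambda>z. N z v) has_derivative
      (\<lambda>h. - (\<Sum>b\<in>Basis. (\<Sum>c\<in>Basis. (N z v \<bullet> c) *\<^sub>R (?M' z c h \<bullet> b)) *\<^sub>R N z b))) (at z)" if "z \<in> S" for z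
    using has_derivative_inverse_operator[OF S that M N NM MN d] by simp
  moreover have "diff_upto k S (\<lambda>z. - (\<Sum>b\<in>Basis. (\<Sum>c\<in>Basis. (N z v \<bullet> c) *\<^sub>R (?M' z c h \<bullet> b)) *\<^sub>R N z b))" for h
    by (intro diff_upto_linear[OF S bounded_linear_minus[OF bounded_linear_ident]]
          diff_upto_sum[OF S] diff_upto_scaleR[OF S] diff_upto_inner[OF S] IH M')
  ultimately show ?case by (rule diff_upto_SucI[OF S])
qed

lemma smooth_on_subset: "smooth_on S f \<Longrightarrow> T \<subseteq> S \<Longrightarrow> smooth_on T f"
  unfolding smooth_on_def by blast

lemma smooth_on_cong:
  "open S \<Longrightarrow> (\<And>z. z \<in> S \<Longrightarrow> f z = g z) \<Longrightarrow> smooth_on S f \<Longrightarrow> smooth_on S g"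
  unfolding smooth_on_iff_diff_upto using diff_upto_cong by blast

lemma smooth_on_local:
  assumes "\<And>z. z \<in> S \<Longrightarrow> \<exists>T g. open T \<and> z \<in> T \<and> smooth_on T g \<and> (\<forall>y\<in>T. f y = g y)"
  shows "smooth_on S f"
  unfolding smooth_on_def
proof (intro allI ballI)
  fix vs z assume "z \<in> S"
  then obtain T g where T: "open T" "z \<in> T" "smooth_on T g" "\<forall>y\<in>T. f y = g y"
    using assms by blast
  then have "smooth_on T f" using smooth_on_cong[of T g f] by auto
  then show "iter_deriv vs f differentiable (at z)" using T by (simp add: smooth_on_def)
qed

lemma smooth_on_compose:
  "open S \<Longrightarrow> open T \<Longrightarrow> smooth_on S f \<Longrightarrow> smooth_on T g \<Longrightarrow> f ` S \<subseteq> T \<Longrightarrow> smooth_on S (g \<circ> f)"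
  unfolding smooth_on_iff_diff_upto using diff_upto_compose by blast

lemma smooth_on_linear:
  "open S \<Longrightarrow> bounded_linear L \<Longrightarrow> smooth_on S f \<Longrightarrow> smooth_on S (\<lambda>z. L (f z))"
  unfolding smooth_on_iff_diff_upto using diff_upto_linear by blast

lemma smooth_on_Pair:
  assumes S: "open S" and f: "smooth_on S f" and g: "smooth_on S g"
  shows "smooth_on S (\<lambda>z. (f z, g z))"
proof -
  have "bounded_linear (\<lambda>u::'b. (u, 0::'c))" "bounded_linear (\<lambda>u::'c. (0::'b, u))"
    by (intro bounded_linear_Pair bounded_linear_ident bounded_linear_zero)+
  then have "smooth_on S (\<lambda>z. (f z, 0) + (0, g z))"
    using f g unfolding smooth_on_iff_diff_upto
    by (intro allI diff_upto_add[OF S])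
      (use diff_upto_linear[OF S, where L = "\<lambda>u. (u, 0)"] diff_upto_linear[OF S, where L = "\<lambda>u. (0, u)"] in blast)+
  then show ?thesis by simp
qed

lemma smooth_on_deriv: "smooth_on S f \<Longrightarrow> smooth_on S (\<lambda>z. frechet_derivative f (at z) v)"
  unfolding smooth_on_iff_diff_upto using diff_upto_Suc by blast

lemma smooth_on_has_derivative:
  "smooth_on S f \<Longrightarrow> z \<in> S \<Longrightarrow> (f has_derivative frechet_derivative f (at z)) (at z)"
  unfolding smooth_on_iff_diff_upto using diff_upto_has_derivative by blast

lemma smooth_on_isCont: "smooth_on S f \<Longrightarrow> z \<in> S \<Longrightarrow> isCont f z"
  using smooth_on_has_derivative has_derivative_continuous by blast

lemma smooth_on_continuous: "smooth_on S f \<Longrightarrow> continuous_on S f"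
  by (intro continuous_at_imp_continuous_on ballI) (rule smooth_on_isCont)

text \<open>
  The inverse function theorem for \<open>C\<^sup>\<infinity>\<close> maps, the injectivity of \<open>f\<close> being given. Openness of the image is
  invariance of domain. For \<open>g = f\<^sup>-\<^sup>1\<close>, the relation \<open>Dg(y) = Df(g y)\<^sup>-\<^sup>1\<close> expresses \<open>Dg\<close> as the composite
  of \<open>g\<close> with a smooth map, and one bootstraps on the order of differentiability.
\<close>

lemma smooth_on_inv_into:
  fixes f :: "'e::euclidean_space \<Rightarrow> 'e"
  assumes S: "open S" and f: "smooth_on S f" and inj: "inj_on f S"
    and D: "\<And>z. z \<in> S \<Longrightarrow> inj (frechet_derivative f (at z))"
  shows "open (f ` S)" "smooth_on (f ` S) (inv_into S f)"
proof -
  have cont: "continuous_on S f" by (rule smooth_on_continuous[OF f])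
  show op: "open (f ` S)" by (rule invariance_of_domain[OF cont S inj])
  let ?g = "inv_into S f"
  define M where "M = (\<lambda>z. frechet_derivative f (at z))"
  define N where "N = (\<lambda>z. inv (M z))"
  have M: "linear (M z)" if "z \<in> S" for z
    unfolding M_def using smooth_on_has_derivative[OF f that] has_derivative_linear by blast
  have inv: "linear (N z)" "N z (M z u) = u" "M z (N z u) = u" if "z \<in> S" for z u
  proof -
    have i: "inj (M z)" using D[OF that] by (simp add: M_def)
    have s: "surj (M z)" using linear_inj_imp_surj[OF M[OF that] i] .
    show "N z (M z u) = u" using i by (simp add: N_def)
    show "M z (N z u) = u" using s by (simp add: N_def surj_f_inv_f)
    show "linear (N z)"
      unfolding N_def by (rule inj_linear_imp_inv_linear[OF M[OF that] i])
  qed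
  have dg: "(?g has_derivative N (?g y)) (at y)" if "y \<in> f ` S" for y
  proof (rule has_derivative_inverse_strong_x[OF S])
    show zS: "?g y \<in> S" using that by (rule inv_into_into)
    show "continuous_on S f" by (rule cont)
    show "?g (f z) = z" if "z \<in> S" for z using inj that by simp
    show "(f has_derivative M (?g y)) (at (?g y))" unfolding M_def by (rule smooth_on_has_derivative[OF f zS])
    show "M (?g y) \<circ> N (?g y) = id" using inv(3)[OF zS] by auto
    show "f (?g y) = y" using that by (rule f_inv_into_f)
  qed
  have Nk: "diff_upto k S (\<lambda>z. N z v)" for k v
    by (rule diff_upto_inverse_operator[OF S M inv])
      (use smooth_on_deriv[OF f] in \<open>auto simp: M_def smooth_on_iff_diff_upto\<close>)
  have "diff_upto k (f ` S) ?g" for k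
  proof (induction k)
    case 0
    then show ?case unfolding diff_upto_0 differentiable_def using dg by blast
  next
    case (Suc k)
    show ?case
    proof (rule diff_upto_SucI[OF op dg])
      have "diff_upto k (f ` S) ((\<lambda>z. N z v) \<circ> ?g)" for v
        by (rule diff_upto_compose[OF op S _ Suc.IH Nk]) (auto intro: inv_into_into)
      then show "diff_upto k (f ` S) (\<lambda>y. N (?g y) v)" for v by (simp add: o_def)
    qed
  qed
  then show "smooth_on (f ` S) ?g" by (simp add: smooth_on_iff_diff_upto)
qed

lemma linear_norm_le_sum_Basis:
  fixes u :: "'e::euclidean_space"
  assumes "linear L"
  shows "norm (L u) \<le> (\<Sum>b\<in>Basis. norm (L b)) * norm u"
proof -
  have "norm (L u) \<le> (\<Sum>b\<in>Basis. norm ((u \<bullet> b) *\<^sub>R L b))"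
    unfolding linear_eq_sum_Basis[OF assms, of u] by (rule norm_sum)
  also have "\<dots> \<le> (\<Sum>b\<in>Basis. norm u * norm (L b))"
    by (intro sum_mono) (simp add: Basis_le_norm mult_right_mono)
  finally show ?thesis by (simp add: sum_distrib_left mult.commute)
qed

text \<open>
  Injective linear maps form an open set; closeness is measured on the basis vectors, because
  differentials are controlled one directional derivative at a time.
\<close>

lemma inj_linear_perturbation:
  fixes L :: "'e::euclidean_space \<Rightarrow> 'f::euclidean_space"
  assumes L: "linear L" "inj L"
  obtains e where "e > 0"
    "\<And>M. linear M \<Longrightarrow> (\<And>b. b \<in> Basis \<Longrightarrow> norm (M b - L b) < e) \<Longrightarrow> inj M"
proof -
  obtain B where B: "B > 0" "\<And>u. B * norm u \<le> norm (L u)"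
    using linear_inj_bounded_below_pos[OF L] by blast
  let ?e = "B / DIM('e)"
  show thesis
  proof
    show "?e > 0" using B by simp
    fix M :: "'e \<Rightarrow> 'f" assume M: "linear M" and close: "\<And>b. b \<in> Basis \<Longrightarrow> norm (M b - L b) < ?e"
    have lin: "linear (\<lambda>u. M u - L u)" using M L(1) by (rule linear_compose_sub)
    have "(\<Sum>b\<in>(Basis::'e set). norm (M b - L b)) < (\<Sum>b\<in>(Basis::'e set). ?e)"
      by (intro sum_strict_mono close) auto
    then have lt: "(\<Sum>b\<in>(Basis::'e set). norm (M b - L b)) < B" by simp
    have "u = 0" if "M u = 0" for u
    proof (rule ccontr)
      assume "u \<noteq> 0"
      have "B * norm u \<le> norm (M u - L u)" using B(2)[of u] that by simp
      also have "\<dots> \<le> (\<Sum>b\<in>Basis. norm (M b - L b)) * norm u" by (rule linear_norm_le_sum_Basis[OF lin])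
      also have "\<dots> < B * norm u" using lt \<open>u \<noteq> 0\<close> by simp
      finally show False by simp
    qed
    then show "inj M" using linear_injective_0[OF M] by blast
  qed
qed

text \<open>
  Both conclusions hold near \<open>z\<close> because \<open>Df\<close> is continuous: injectivity of \<open>f\<close> by the mean value
  inequality, and injectivity of \<open>Df\<close> because it is an open condition.
\<close>

lemma smooth_on_locally_injective:
  fixes f :: "'e::euclidean_space \<Rightarrow> 'f::euclidean_space"
  assumes S: "open S" and z: "z \<in> S" and f: "smooth_on S f"
    and D: "inj (frechet_derivative f (at z))"
  obtains S' where "open S'" "z \<in> S'" "S' \<subseteq> S" "inj_on f S'"
    "\<And>y. y \<in> S' \<Longrightarrow> inj (frechet_derivative f (at y))"
proof -
  let ?D = "\<lambda>y. frechet_derivative f (at y)"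
  have lin: "linear (?D y)" if "y \<in> S" for y
    using smooth_on_has_derivative[OF f that] has_derivative_linear by blast
  obtain g' where g': "linear g'" "g' \<circ> ?D z = id"
    using linear_injective_left_inverse[OF lin[OF z] D] by blast
  have close: "\<exists>d>0. ball z d \<subseteq> S \<and> (\<forall>y\<in>ball z d. \<forall>b\<in>Basis. norm (?D y b - ?D z b) < e)" if "e > 0" for e
  proof -
    have "\<forall>\<^sub>F y in nhds z. \<forall>b\<in>Basis. norm (?D y b - ?D z b) < e"
    proof (intro eventually_ball_finite ballI)
      fix b :: 'e
      have "((\<lambda>y. ?D y b) \<longlongrightarrow> ?D z b) (nhds z)"
        using smooth_on_isCont[OF smooth_on_deriv[OF f] z] isCont_def tendsto_at_iff_tendsto_nhds by blast
      then show "\<forall>\<^sub>F y in nhds z. norm (?D y b - ?D z b) < e"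
        using \<open>e > 0\<close> by (auto dest: tendstoD simp: dist_norm)
    qed simp
    moreover have "\<forall>\<^sub>F y in nhds z. y \<in> S" using S z eventually_nhds by blast
    ultimately have "\<forall>\<^sub>F y in nhds z. y \<in> S \<and> (\<forall>b\<in>Basis. norm (?D y b - ?D z b) < e)"
      by (rule eventually_conj[rotated])
    then show ?thesis unfolding eventually_nhds_metric by (auto simp: dist_commute)
  qed
  obtain r where r: "r > 0" "ball z r \<subseteq> S" "inj_on f (ball z r)"
  proof (rule has_derivative_locally_injective[where f = f and f' = ?D and g' = g'])
    show "z \<in> S" "open S" "g' \<circ> ?D z = id" by fact+
    show "bounded_linear g'" using g'(1) by (simp add: linear_conv_bounded_linear)
    show "(f has_derivative ?D y) (at y)" if "y \<in> S" for y by (rule smooth_on_has_derivative[OF f that])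
    fix e :: real assume "e > 0"
    \<comment> \<open>Dividing by the dimension makes the sum of the errors on the basis vectors at most \<open>e / 2\<close>.\<close>
    let ?e = "e / 2 / DIM('e)"
    have "?e > 0" using \<open>e > 0\<close> by simp
    from close[OF this] obtain d where d: "d > 0" "ball z d \<subseteq> S"
      "\<forall>y\<in>ball z d. \<forall>b\<in>Basis. norm (?D y b - ?D z b) < ?e" by blast
    have "onorm (\<lambda>v. ?D y v - ?D z v) < e" if "dist z y < d" for y
    proof -
      have "y \<in> S" using d that by auto
      have "norm (?D y v - ?D z v) \<le> (e / 2) * norm v" for v
      proof -
        have "(\<Sum>b\<in>(Basis::'e set). norm (?D y b - ?D z b)) \<le> (\<Sum>b\<in>(Basis::'e set). ?e)"
          using d(3) that by (intro sum_mono less_imp_le) auto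
        then have le: "(\<Sum>b\<in>(Basis::'e set). norm (?D y b - ?D z b)) \<le> e / 2" by simp
        have "norm (?D y v - ?D z v) \<le> (\<Sum>b\<in>Basis. norm (?D y b - ?D z b)) * norm v"
          by (rule linear_norm_le_sum_Basis[OF linear_compose_sub[OF lin[OF \<open>y \<in> S\<close>] lin[OF z]]])
        also have "\<dots> \<le> (e / 2) * norm v" using le by (intro mult_right_mono) auto
        finally show ?thesis .
      qed
      then have "onorm (\<lambda>v. ?D y v - ?D z v) \<le> e / 2" by (intro onorm_le) 
      then show ?thesis using \<open>e > 0\<close> by simp
    qed
    then show "\<exists>d>0. \<forall>y. dist z y < d \<longrightarrow> onorm (\<lambda>v. ?D y v - ?D z v) < e" using d(1) by blast
  qed
  obtain e where e: "e > 0"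
    "\<And>M. linear M \<Longrightarrow> (\<And>b. b \<in> Basis \<Longrightarrow> norm (M b - ?D z b) < e) \<Longrightarrow> inj M"
    using inj_linear_perturbation[OF lin[OF z] D] by blast
  from close[OF e(1)] obtain d where d: "d > 0" "ball z d \<subseteq> S"
    "\<forall>y\<in>ball z d. \<forall>b\<in>Basis. norm (?D y b - ?D z b) < e" by blast
  show thesis
  proof
    show "open (ball z (min r d))" "z \<in> ball z (min r d)" "ball z (min r d) \<subseteq> S"
      using r d by auto
    show "inj_on f (ball z (min r d))" using r(3) by (rule inj_on_subset) auto
    show "inj (?D y)" if "y \<in> ball z (min r d)" for y
      using that d lin[of y] by (intro e(2)) auto
  qed
qed

section \<open>Smooth maps and charts of a manifold\<close>

lemma is_chart_inj: "is_chart (U, \<alpha>) \<Longrightarrow> inj_on \<alpha> U"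
  unfolding is_chart_def homeomorphism_def by (auto intro: inj_on_inverseI)

lemma is_chart_continuous:
  assumes "is_chart (U, \<alpha>)"
  shows "continuous_on U \<alpha>" "continuous_on (\<alpha> ` U) (inv_into U \<alpha>)"
  using assms unfolding is_chart_def homeomorphism_def by auto

lemma is_chart_open_image:
  assumes c: "is_chart (U, \<alpha>)" and D: "open D" "D \<subseteq> U"
  shows "open (\<alpha> ` D)"
proof -
  have op: "open U" "open (\<alpha> ` U)" using c by (auto simp: is_chart_def)
  have "openin (top_of_set U) D" using op D by (simp add: open_subset)
  moreover have "homeomorphism U (\<alpha> ` U) \<alpha> (inv_into U \<alpha>)" using c by (simp add: is_chart_def)
  ultimately have "openin (top_of_set (\<alpha> ` U)) (\<alpha> ` D)" using homeomorphism_imp_open_map by blast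
  then show ?thesis using op(2) openin_open_eq by blast
qed

lemma is_chart_inv: "is_chart (U, \<alpha>) \<Longrightarrow> p \<in> U \<Longrightarrow> inv_into U \<alpha> (\<alpha> p) = p"
  using is_chart_inj inv_into_f_f by metis

lemma is_chart_open: "is_chart (U, \<alpha>) \<Longrightarrow> open U"
  by (simp add: is_chart_def)

lemma smooth_atlas_chart: "smooth_atlas A \<Longrightarrow> (U, \<alpha>) \<in> A \<Longrightarrow> is_chart (U, \<alpha>)"
  unfolding smooth_atlas_def by blast

lemma smooth_atlas_cover:
  assumes "smooth_atlas A" obtains U \<alpha> where "(U, \<alpha>) \<in> A" "p \<in> U"
proof -
  have "p \<in> (\<Union>c\<in>A. fst c)" using assms unfolding smooth_atlas_def by auto
  then show thesis using that by force
qed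

lemma smooth_atlas_change:
  "smooth_atlas A \<Longrightarrow> (U, \<alpha>) \<in> A \<Longrightarrow> (W, \<beta>) \<in> A \<Longrightarrow> smooth_on (\<alpha> ` (U \<inter> W)) (\<beta> \<circ> inv_into U \<alpha>)"
  unfolding smooth_atlas_def by blast

text \<open>
  Smoothness of a map from the manifold to a Euclidean space. Coordinates of charts, transverse
  coordinates of foliations and their composites with diffeomorphisms are all of this kind.
\<close>

definition coord_smooth ::
  "('a::topological_space, 'e::euclidean_space) chart set \<Rightarrow> 'a set \<Rightarrow> ('a \<Rightarrow> 'f::euclidean_space) \<Rightarrow> bool"
where
  "coord_smooth A D f \<longleftrightarrow> (\<forall>(U, \<alpha>)\<in>A. smooth_on (\<alpha> ` (U \<inter> D)) (f \<circ> inv_into U \<alpha>))"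

text \<open>
  The members of the maximal atlas generated by \<open>A\<close>. Foliated charts are compatible, and so are the
  charts built below from transverse coordinates.
\<close>

definition compatible_chart ::
  "('a::topological_space, 'e::euclidean_space) chart set \<Rightarrow> ('a, 'e) chart \<Rightarrow> bool"
where
  "compatible_chart A = (\<lambda>(N, \<gamma>). is_chart (N, \<gamma>) \<and> coord_smooth A N \<gamma> \<and>
     (\<forall>(U, \<alpha>)\<in>A. smooth_on (\<gamma> ` (N \<inter> U)) (\<alpha> \<circ> inv_into N \<gamma>)))"

lemma compatible_chartI:
  assumes "smooth_atlas (A \<union> F)" "(N, \<gamma>) \<in> A \<union> F"
  shows "compatible_chart A (N, \<gamma>)"
  using assms unfolding compatible_chart_def coord_smooth_def
  by (auto intro: smooth_atlas_chart smooth_atlas_change)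

lemma coord_smoothD: "coord_smooth A D f \<Longrightarrow> (U, \<alpha>) \<in> A \<Longrightarrow> smooth_on (\<alpha> ` (U \<inter> D)) (f \<circ> inv_into U \<alpha>)"
  unfolding coord_smooth_def by blast

lemma coord_smooth_subset: "coord_smooth A D f \<Longrightarrow> D' \<subseteq> D \<Longrightarrow> coord_smooth A D' f"
  unfolding coord_smooth_def by (fast intro: smooth_on_subset)

lemma coord_smooth_linear:
  assumes "smooth_atlas A" "open D" "bounded_linear L" "coord_smooth A D f"
  shows "coord_smooth A D (\<lambda>z. L (f z))"
  unfolding coord_smooth_def
proof clarify
  fix U \<alpha> assume U: "(U, \<alpha>) \<in> A"
  have c: "is_chart (U, \<alpha>)" using smooth_atlas_chart[OF assms(1) U] .
  have "open (\<alpha> ` (U \<inter> D))" using is_chart_open_image[OF c] is_chart_open[OF c] assms(2) by blast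
  from smooth_on_linear[OF this assms(3) coord_smoothD[OF assms(4) U]]
  show "smooth_on (\<alpha> ` (U \<inter> D)) ((\<lambda>z. L (f z)) \<circ> inv_into U \<alpha>)" by (simp add: o_def)
qed

lemma coord_smooth_Pair:
  assumes "smooth_atlas A" "open D" "coord_smooth A D f" "coord_smooth A D g"
  shows "coord_smooth A D (\<lambda>z. (f z, g z))"
  unfolding coord_smooth_def
proof clarify
  fix U \<alpha> assume U: "(U, \<alpha>) \<in> A"
  have c: "is_chart (U, \<alpha>)" using smooth_atlas_chart[OF assms(1) U] .
  have "open (\<alpha> ` (U \<inter> D))" using is_chart_open_image[OF c] is_chart_open[OF c] assms(2) by blast
  from smooth_on_Pair[OF this coord_smoothD[OF assms(3) U] coord_smoothD[OF assms(4) U]]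
  show "smooth_on (\<alpha> ` (U \<inter> D)) ((\<lambda>z. (f z, g z)) \<circ> inv_into U \<alpha>)" by (simp add: o_def)
qed

lemma coord_smooth_continuous:
  assumes A: "smooth_atlas A" and D: "open D" and f: "coord_smooth A D f"
  shows "continuous_on D f"
proof -
  have "continuous_on (\<Union>c\<in>A. fst c \<inter> D) f"
  proof (rule continuous_on_open_UN)
    fix c assume "c \<in> A"
    then obtain U \<alpha> where U: "c = (U, \<alpha>)" "(U, \<alpha>) \<in> A" by (cases c) auto
    have c: "is_chart (U, \<alpha>)" using smooth_atlas_chart[OF A U(2)] .
    show "open (fst c \<inter> D)" using is_chart_open[OF c] D U(1) by auto
    have "continuous_on (\<alpha> ` (U \<inter> D)) (f \<circ> inv_into U \<alpha>)"
      by (rule smooth_on_continuous[OF coord_smoothD[OF f U(2)]])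
    moreover have "continuous_on (U \<inter> D) \<alpha>"
      using is_chart_continuous(1)[OF c] by (rule continuous_on_subset) auto
    ultimately have "continuous_on (U \<inter> D) ((f \<circ> inv_into U \<alpha>) \<circ> \<alpha>)"
      by (rule continuous_on_compose[rotated])
    then have "continuous_on (U \<inter> D) f"
      by (rule continuous_on_eq) (simp add: is_chart_inv[OF c])
    then show "continuous_on (fst c \<inter> D) f" using U(1) by simp
  qed
  moreover have "(\<Union>c\<in>A. fst c \<inter> D) = D" using A unfolding smooth_atlas_def by auto
  ultimately show ?thesis by simp
qed

lemma smooth_map_on_iff:
  "smooth_map_on A D f \<longleftrightarrow>
     continuous_on D f \<and> (\<forall>(W, \<beta>)\<in>A. coord_smooth A (D \<inter> f -` W) (\<beta> \<circ> f))"
  unfolding smooth_map_on_def coord_smooth_def by (auto simp: Int_assoc)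

text \<open>
  Near a point \<open>p\<close>, insert a chart \<open>\<beta>\<close> around \<open>f p\<close>: in coordinates the composite is
  \<open>(g \<circ> \<beta>\<^sup>-\<^sup>1) \<circ> (\<beta> \<circ> f \<circ> \<alpha>\<^sup>-\<^sup>1)\<close>.
\<close>

lemma coord_smooth_compose:
  assumes A: "smooth_atlas A" and D: "open D" "open D'" and fD: "f ` D \<subseteq> D'"
    and f: "smooth_map_on A D f" and g: "coord_smooth A D' g"
  shows "coord_smooth A D (g \<circ> f)"
  unfolding coord_smooth_def
proof clarify
  fix U \<alpha> assume U: "(U, \<alpha>) \<in> A"
  have c: "is_chart (U, \<alpha>)" using smooth_atlas_chart[OF A U] .
  have contf: "continuous_on D f" using f by (simp add: smooth_map_on_def)
  show "smooth_on (\<alpha> ` (U \<inter> D)) (g \<circ> f \<circ> inv_into U \<alpha>)"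
  proof (rule smooth_on_local)
    fix z assume "z \<in> \<alpha> ` (U \<inter> D)"
    then obtain p where p: "p \<in> U" "p \<in> D" "z = \<alpha> p" by blast
    obtain W \<beta> where W: "(W, \<beta>) \<in> A" "f p \<in> W" using smooth_atlas_cover[OF A] .
    have d: "is_chart (W, \<beta>)" using smooth_atlas_chart[OF A W(1)] .
    let ?P = "U \<inter> D \<inter> f -` W"
    have "open (U \<inter> (D \<inter> f -` W))"
      using continuous_open_preimage[OF contf D(1) is_chart_open[OF d]] is_chart_open[OF c] by blast
    then have opT: "open (\<alpha> ` ?P)" by (intro is_chart_open_image[OF c]) (auto simp: Int_assoc)
    have op2: "open (\<beta> ` (W \<inter> D'))"
      using is_chart_open_image[OF d] is_chart_open[OF d] D(2) by blast
    have "smooth_on (\<alpha> ` ?P) (\<beta> \<circ> f \<circ> inv_into U \<alpha>)"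
      using f U W(1) unfolding smooth_map_on_def by blast
    from smooth_on_compose[OF opT op2 this coord_smoothD[OF g W(1)]]
    have "smooth_on (\<alpha> ` ?P) ((g \<circ> inv_into W \<beta>) \<circ> (\<beta> \<circ> f \<circ> inv_into U \<alpha>))"
      using fD by (force simp: is_chart_inv[OF c])
    moreover have "\<forall>y\<in>\<alpha> ` ?P. (g \<circ> f \<circ> inv_into U \<alpha>) y = ((g \<circ> inv_into W \<beta>) \<circ> (\<beta> \<circ> f \<circ> inv_into U \<alpha>)) y"
      by (auto simp: is_chart_inv[OF c] is_chart_inv[OF d])
    ultimately show "\<exists>T h. open T \<and> z \<in> T \<and> smooth_on T h \<and> (\<forall>y\<in>T. (g \<circ> f \<circ> inv_into U \<alpha>) y = h y)"
      using opT p W(2) by blast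
  qed
qed

lemma smooth_map_on_subset:
  "smooth_map_on A D f \<Longrightarrow> D' \<subseteq> D \<Longrightarrow> smooth_map_on A D' f"
  unfolding smooth_map_on_iff by (fast intro: coord_smooth_subset continuous_on_subset)

lemma smooth_map_on_compose:
  assumes A: "smooth_atlas A" and D: "open D" "open D'" and fD: "f ` D \<subseteq> D'"
    and f: "smooth_map_on A D f" and g: "smooth_map_on A D' g"
  shows "smooth_map_on A D (g \<circ> f)"
  unfolding smooth_map_on_iff
proof (intro conjI, goal_cases)
  case 1
  show ?case using f g fD unfolding smooth_map_on_def
    by (meson continuous_on_compose continuous_on_subset)
next
  case 2
  show ?case
  proof clarify
    fix W \<beta> assume W: "(W, \<beta>) \<in> A"
    have d: "is_chart (W, \<beta>)" using smooth_atlas_chart[OF A W] .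
    have contf: "continuous_on D f" and contg: "continuous_on D' g"
      using f g by (simp_all add: smooth_map_on_def)
    let ?D' = "D' \<inter> g -` W"
    have op': "open ?D'" by (rule continuous_open_preimage[OF contg D(2) is_chart_open[OF d]])
    have eq: "D \<inter> (g \<circ> f) -` W = D \<inter> f -` ?D'" using fD by auto
    have "coord_smooth A (D \<inter> f -` ?D') ((\<beta> \<circ> g) \<circ> f)"
    proof (rule coord_smooth_compose[OF A _ op'])
      show "open (D \<inter> f -` ?D')" by (rule continuous_open_preimage[OF contf D(1) op'])
      show "smooth_map_on A (D \<inter> f -` ?D') f" using f by (rule smooth_map_on_subset) auto
      show "coord_smooth A ?D' (\<beta> \<circ> g)" using g W unfolding smooth_map_on_iff by blast
    qed auto
    then show "coord_smooth A (D \<inter> (g \<circ> f) -` W) (\<beta> \<circ> (g \<circ> f))" by (simp add: eq o_assoc)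
  qed
qed

lemma smooth_map_on_cong:
  assumes A: "smooth_atlas A" and D: "open D" and eq: "\<And>z. z \<in> D \<Longrightarrow> f z = g z"
    and f: "smooth_map_on A D f"
  shows "smooth_map_on A D g"
  unfolding smooth_map_on_def
proof (intro conjI, goal_cases)
  case 1
  show ?case using f eq unfolding smooth_map_on_def by (metis continuous_on_eq)
next
  case 2
  show ?case
  proof clarify
    fix U \<alpha> W \<beta> assume U: "(U, \<alpha>) \<in> A" and W: "(W, \<beta>) \<in> A"
    have c: "is_chart (U, \<alpha>)" and d: "is_chart (W, \<beta>)" using smooth_atlas_chart[OF A] U W by auto
    have contf: "continuous_on D f" using f by (simp add: smooth_map_on_def)
    have set: "U \<inter> D \<inter> g -` W = U \<inter> (D \<inter> f -` W)" using eq by auto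
    have op: "open (\<alpha> ` (U \<inter> D \<inter> g -` W))"
      unfolding set
      using continuous_open_preimage[OF contf D is_chart_open[OF d]] is_chart_open[OF c]
      by (intro is_chart_open_image[OF c]) auto
    show "smooth_on (\<alpha> ` (U \<inter> D \<inter> g -` W)) (\<beta> \<circ> g \<circ> inv_into U \<alpha>)"
    proof (rule smooth_on_cong[OF op])
      show "smooth_on (\<alpha> ` (U \<inter> D \<inter> g -` W)) (\<beta> \<circ> f \<circ> inv_into U \<alpha>)"
        using f U W unfolding smooth_map_on_def set by (auto simp: Int_assoc)
      show "(\<beta> \<circ> f \<circ> inv_into U \<alpha>) z = (\<beta> \<circ> g \<circ> inv_into U \<alpha>) z"
        if "z \<in> \<alpha> ` (U \<inter> D \<inter> g -` W)" for z
        using that eq by (auto simp: is_chart_inv[OF c])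
    qed
  qed
qed

text \<open>
  This is how maps of the manifold into itself are produced: prescribe the coordinates of the image
  point in some compatible chart.
\<close>

lemma smooth_map_on_inv_chart:
  assumes A: "smooth_atlas A" and D: "open D" and N: "compatible_chart A (N, \<gamma>)"
    and f: "coord_smooth A D f" and fD: "f ` D \<subseteq> \<gamma> ` N"
  shows "smooth_map_on A D (inv_into N \<gamma> \<circ> f)"
  unfolding smooth_map_on_def
proof (rule conjI)
  have N': "is_chart (N, \<gamma>)" using N by (simp add: compatible_chart_def)
  have contf: "continuous_on D f" by (rule coord_smooth_continuous[OF A D f])
  show cont: "continuous_on D (inv_into N \<gamma> \<circ> f)"
    using contf is_chart_continuous(2)[OF N'] fD by (meson continuous_on_compose continuous_on_subset)
  show "\<forall>(U, \<alpha>)\<in>A. \<forall>(W, \<beta>)\<in>A.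
      smooth_on (\<alpha> ` (U \<inter> D \<inter> (inv_into N \<gamma> \<circ> f) -` W)) (\<beta> \<circ> (inv_into N \<gamma> \<circ> f) \<circ> inv_into U \<alpha>)"
  proof clarify
    fix U \<alpha> W \<beta> assume U: "(U, \<alpha>) \<in> A" and W: "(W, \<beta>) \<in> A"
    have c: "is_chart (U, \<alpha>)" and d: "is_chart (W, \<beta>)" using smooth_atlas_chart[OF A] U W by auto
    let ?P = "U \<inter> D \<inter> (inv_into N \<gamma> \<circ> f) -` W"
    have "open (U \<inter> (D \<inter> (inv_into N \<gamma> \<circ> f) -` W))"
      using continuous_open_preimage[OF cont D is_chart_open[OF d]] is_chart_open[OF c] by blast
    then have op: "open (\<alpha> ` ?P)" by (intro is_chart_open_image[OF c]) (auto simp: Int_assoc)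
    have op': "open (\<gamma> ` (N \<inter> W))"
      using is_chart_open_image[OF N'] is_chart_open[OF N'] is_chart_open[OF d] by blast
    have sub: "(f \<circ> inv_into U \<alpha>) ` \<alpha> ` ?P \<subseteq> \<gamma> ` (N \<inter> W)"
    proof clarify
      fix p assume p: "p \<in> U" "p \<in> D" "(inv_into N \<gamma> \<circ> f) p \<in> W"
      then obtain q where "q \<in> N" "f p = \<gamma> q" using fD by blast
      then show "(f \<circ> inv_into U \<alpha>) (\<alpha> p) \<in> \<gamma> ` (N \<inter> W)"
        using p by (auto simp: is_chart_inv[OF c] is_chart_inv[OF N'])
    qed
    have "smooth_on (\<alpha> ` ?P) (f \<circ> inv_into U \<alpha>)"
      using coord_smoothD[OF f U] by (rule smooth_on_subset) auto
    moreover have "smooth_on (\<gamma> ` (N \<inter> W)) (\<beta> \<circ> inv_into N \<gamma>)"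
      using N W unfolding compatible_chart_def by blast
    ultimately have "smooth_on (\<alpha> ` ?P) ((\<beta> \<circ> inv_into N \<gamma>) \<circ> (f \<circ> inv_into U \<alpha>))"
      by (rule smooth_on_compose[OF op op' _ _ sub])
    then show "smooth_on (\<alpha> ` ?P) (\<beta> \<circ> (inv_into N \<gamma> \<circ> f) \<circ> inv_into U \<alpha>)"
      by (simp add: o_assoc)
  qed
qed

lemma diffeo_onI:
  assumes A: "smooth_atlas A" and D: "open D" and fD: "open (f ` D)" and f: "smooth_map_on A D f"
    and g: "smooth_map_on A (f ` D) g" and gf: "\<And>z. z \<in> D \<Longrightarrow> g (f z) = z"
  shows "diffeo_on A D f"
proof -
  have inj: "inj_on f D" using gf by (rule inj_on_inverseI)
  have "smooth_map_on A (f ` D) (inv_into D f)"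
    by (rule smooth_map_on_cong[OF A fD _ g]) (use gf inj in auto)
  then show ?thesis using assms inj by (simp add: diffeo_on_def)
qed

lemma diffeo_on_subset:
  assumes A: "smooth_atlas A" and f: "diffeo_on A D f" and D': "open D'" "D' \<subseteq> D"
  shows "diffeo_on A D' f"
proof (rule diffeo_onI[OF A D'(1)])
  have cont: "continuous_on (f ` D) (inv_into D f)" and inj: "inj_on f D" and op: "open (f ` D)"
    using f by (auto simp: diffeo_on_def smooth_map_on_def)
  have "f ` D' = f ` D \<inter> inv_into D f -` D'"
    using D'(2) inj by (auto simp: inj_on_image_mem_iff subset_iff)
  then show "open (f ` D')" using continuous_open_preimage[OF cont op D'(1)] by simp
  show "smooth_map_on A D' f" using f D'(2) unfolding diffeo_on_def by (blast intro: smooth_map_on_subset)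
  show "smooth_map_on A (f ` D') (inv_into D f)"
    using f D'(2) unfolding diffeo_on_def by (blast intro: smooth_map_on_subset)
  show "inv_into D f (f z) = z" if "z \<in> D'" for z using inj D'(2) that by (auto intro: inv_into_f_f)
qed

lemma diffeo_on_compose:
  assumes A: "smooth_atlas A" and f: "diffeo_on A D f" and g: "diffeo_on A (f ` D) g"
  shows "diffeo_on A D (g \<circ> f)"
proof (rule diffeo_onI[OF A])
  let ?h = "inv_into D f \<circ> inv_into (f ` D) g"
  have op: "open D" "open (f ` D)" "open (g ` f ` D)" and inj: "inj_on f D" "inj_on g (f ` D)"
    using f g by (auto simp: diffeo_on_def)
  show "open D" "open ((g \<circ> f) ` D)" using op by (simp_all add: image_comp)
  show "smooth_map_on A D (g \<circ> f)"
    using f g by (intro smooth_map_on_compose[OF A op(1,2)]) (auto simp: diffeo_on_def)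
  have "smooth_map_on A (g ` f ` D) ?h"
    using f g op by (intro smooth_map_on_compose[OF A op(3,2)]) (auto simp: diffeo_on_def inv_into_into)
  then show "smooth_map_on A ((g \<circ> f) ` D) ?h" by (simp add: image_comp)
  show "?h ((g \<circ> f) z) = z" if "z \<in> D" for z using that inj by simp
qed

lemma diffeo_on_inv_into:
  assumes A: "smooth_atlas A" and f: "diffeo_on A D f"
  shows "diffeo_on A (f ` D) (inv_into D f)"
proof (rule diffeo_onI[OF A])
  have inj: "inj_on f D" using f by (simp add: diffeo_on_def)
  have im: "inv_into D f ` f ` D = D" using inj by simp
  show "open (f ` D)" "open (inv_into D f ` f ` D)" "smooth_map_on A (f ` D) (inv_into D f)"
    "smooth_map_on A (inv_into D f ` f ` D) f"
    unfolding im using f by (auto simp: diffeo_on_def)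
  show "f (inv_into D f z) = z" if "z \<in> f ` D" for z using that by (rule f_inv_into_f)
qed

text \<open>
  The inverse has the same form, with the two charts exchanged.
\<close>

lemma diffeo_on_chart_transition:
  assumes A: "smooth_atlas A" and N: "compatible_chart A (N, \<gamma>)" and N': "compatible_chart A (N', \<gamma>')"
    and sub: "\<gamma>' ` N' \<subseteq> \<gamma> ` N"
  shows "diffeo_on A N' (inv_into N \<gamma> \<circ> \<gamma>')"
proof (rule diffeo_onI[OF A])
  let ?f = "inv_into N \<gamma> \<circ> \<gamma>'"
  have c: "is_chart (N, \<gamma>)" and c': "is_chart (N', \<gamma>')" and s: "coord_smooth A N \<gamma>" "coord_smooth A N' \<gamma>'"
    using N N' by (auto simp: compatible_chart_def)
  show "open N'" by (rule is_chart_open[OF c'])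
  have op': "open (\<gamma>' ` N')" using c' by (simp add: is_chart_def)
  have g: "?f z \<in> N" "\<gamma> (?f z) = \<gamma>' z" if "z \<in> N'" for z
    using that sub by (auto simp: inv_into_into f_inv_into_f image_subset_iff)
  have im: "?f ` N' = N \<inter> \<gamma> -` (\<gamma>' ` N')"
  proof
    show "N \<inter> \<gamma> -` (\<gamma>' ` N') \<subseteq> ?f ` N'"
    proof
      fix p assume p: "p \<in> N \<inter> \<gamma> -` (\<gamma>' ` N')"
      then obtain z where "z \<in> N'" "\<gamma> p = \<gamma>' z" by auto
      then have "p = ?f z" using p is_chart_inv[OF c, of p] by auto
      then show "p \<in> ?f ` N'" using \<open>z \<in> N'\<close> by blast
    qed
  qed (use g in auto)
  show op: "open (?f ` N')"
    unfolding im by (rule continuous_open_preimage[OF is_chart_continuous(1)[OF c] is_chart_open[OF c] op'])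
  show "smooth_map_on A N' ?f"
    by (rule smooth_map_on_inv_chart[OF A is_chart_open[OF c'] N s(2) sub])
  show "smooth_map_on A (?f ` N') (inv_into N' \<gamma>' \<circ> \<gamma>)"
    by (rule smooth_map_on_inv_chart[OF A op N' coord_smooth_subset[OF s(1)]]) (use g in auto)
  show "(inv_into N' \<gamma>' \<circ> \<gamma>) (?f z) = z" if "z \<in> N'" for z
    using g(2)[OF that] is_chart_inv[OF c' that] by simp
qed

text \<open>
  The inverse function theorem on a manifold. Both the biregular charts and the coordinates of the
  intermediate map of the decomposition are obtained from it.
\<close>

lemma compatible_chart_of_injective_derivative:
  fixes f :: "'a::topological_space \<Rightarrow> 'e::euclidean_space"
  assumes A: "smooth_atlas A" and U: "(U, \<alpha>) \<in> A" "p \<in> U" and D: "open D" "p \<in> D"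
    and f: "coord_smooth A D f"
    and inj: "inj (frechet_derivative (f \<circ> inv_into U \<alpha>) (at (\<alpha> p)))"
  obtains N where "p \<in> N" "N \<subseteq> D" "compatible_chart A (N, f)"
proof -
  have c: "is_chart (U, \<alpha>)" using smooth_atlas_chart[OF A U(1)] .
  let ?f = "f \<circ> inv_into U \<alpha>"
  have op: "open (\<alpha> ` (U \<inter> D))"
    using is_chart_open_image[OF c] is_chart_open[OF c] D(1) by blast
  have zS: "\<alpha> p \<in> \<alpha> ` (U \<inter> D)" using U D by blast
  obtain S where S: "open S" "\<alpha> p \<in> S" "S \<subseteq> \<alpha> ` (U \<inter> D)" "inj_on ?f S"
    and injS: "\<And>y. y \<in> S \<Longrightarrow> inj (frechet_derivative ?f (at y))"
    using smooth_on_locally_injective[OF op zS coord_smoothD[OF f U(1)] inj] by blast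
  have sm: "smooth_on S ?f" using coord_smoothD[OF f U(1)] S(3) by (rule smooth_on_subset)
  note inv = smooth_on_inv_into[OF S(1) sm S(4) injS]
  define N where "N = U \<inter> \<alpha> -` S"
  have opN: "open N"
    unfolding N_def by (rule continuous_open_preimage[OF is_chart_continuous(1)[OF c] is_chart_open[OF c] S(1)])
  have ND: "N \<subseteq> D"
  proof
    fix q assume "q \<in> N"
    then obtain q' where "q' \<in> U" "q' \<in> D" "\<alpha> q = \<alpha> q'" "q \<in> U" using S(3) unfolding N_def by auto
    then show "q \<in> D" using is_chart_inj[OF c] by (metis inj_onD)
  qed
  have fq: "?f (\<alpha> q) = f q" "\<alpha> q \<in> S" "q \<in> U" if "q \<in> N" for q
    using that is_chart_inv[OF c] by (auto simp: N_def)
  have \<alpha>N: "\<alpha> ` N = S"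
  proof
    show "S \<subseteq> \<alpha> ` N" using S(3) unfolding N_def by auto
  qed (auto simp: N_def)
  have im: "f ` N = ?f ` S"
    unfolding \<alpha>N[symmetric] image_comp using fq(1) by (auto intro!: image_cong)
  have inv_f: "inv_into S ?f (f q) = \<alpha> q" if "q \<in> N" for q
    using fq[OF that] inv_into_f_f[OF S(4), of "\<alpha> q"] by simp
  have injN: "inj_on f N"
    by (rule inj_on_inverseI[where g = "inv_into U \<alpha> \<circ> inv_into S ?f"])
      (use inv_f fq is_chart_inv[OF c] in simp)
  have eq: "inv_into N f y = inv_into U \<alpha> (inv_into S ?f y)" if "y \<in> f ` N" for y
    using that inv_f fq(3) is_chart_inv[OF c] injN by auto
  have cont: "continuous_on N f" by (rule coord_smooth_continuous[OF A opN coord_smooth_subset[OF f ND]])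
  have "continuous_on (f ` N) (inv_into U \<alpha> \<circ> inv_into S ?f)"
  proof (rule continuous_on_compose)
    show "continuous_on (f ` N) (inv_into S ?f)" unfolding im by (rule smooth_on_continuous[OF inv(2)])
    show "continuous_on (inv_into S ?f ` f ` N) (inv_into U \<alpha>)"
      using is_chart_continuous(2)[OF c] by (rule continuous_on_subset) (use inv_f fq(3) in auto)
  qed
  then have cont': "continuous_on (f ` N) (inv_into N f)"
    by (rule continuous_on_eq) (simp add: eq)
  have chart: "is_chart (N, f)"
    unfolding is_chart_def homeomorphism_def
    using opN inv(1)[folded im] cont cont' injN by (simp add: f_inv_into_f)
  have "compatible_chart A (N, f)"
    unfolding compatible_chart_def
  proof (clarify, intro conjI)
    show "is_chart (N, f)" by (rule chart)
    show "coord_smooth A N f" using f ND by (rule coord_smooth_subset)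
    show "\<forall>(W, \<beta>)\<in>A. smooth_on (f ` (N \<inter> W)) (\<beta> \<circ> inv_into N f)"
    proof clarify
      fix W \<beta> assume W: "(W, \<beta>) \<in> A"
      have d: "is_chart (W, \<beta>)" using smooth_atlas_chart[OF A W] .
      have op1: "open (f ` (N \<inter> W))"
        using is_chart_open_image[OF chart] opN is_chart_open[OF d] by blast
      have op2: "open (\<alpha> ` (U \<inter> W))"
        using is_chart_open_image[OF c] is_chart_open[OF c] is_chart_open[OF d] by blast
      have "smooth_on (f ` (N \<inter> W)) (inv_into S ?f)"
        using inv(2)[folded im] by (rule smooth_on_subset) auto
      then have "smooth_on (f ` (N \<inter> W)) ((\<beta> \<circ> inv_into U \<alpha>) \<circ> inv_into S ?f)"
        by (rule smooth_on_compose[OF op1 op2 _ smooth_atlas_change[OF A U(1) W]])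
          (use inv_f fq(3) in auto)
      then show "smooth_on (f ` (N \<inter> W)) (\<beta> \<circ> inv_into N f)"
        by (rule smooth_on_cong[OF op1, rotated]) (auto simp: eq)
    qed
  qed
  moreover have "p \<in> N" using U S(2) by (simp add: N_def)
  ultimately show thesis using that ND by blast
qed

lemma local_diffeo_restrict:
  assumes A: "smooth_atlas A" and f: "diffeo_on A D f"
  shows "local_diffeo A ((Some \<circ> f) |` D)"
proof -
  let ?g = "\<lambda>z. the (((Some \<circ> f) |` D) z)"
  have eq: "?g z = f z" if "z \<in> D" for z using that by simp
  have "diffeo_on A D ?g"
  proof (rule diffeo_onI[OF A, where g = "inv_into D f"])
    have im: "?g ` D = f ` D" using eq by auto
    show "open D" "open (?g ` D)" "smooth_map_on A (?g ` D) (inv_into D f)"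
      unfolding im using f by (simp_all add: diffeo_on_def)
    show "smooth_map_on A D ?g"
      by (rule smooth_map_on_cong[OF A _ _ , where f = f]) (use f in \<open>auto simp: diffeo_on_def\<close>)
    show "inv_into D f (?g z) = z" if "z \<in> D" for z
      using f that by (simp add: diffeo_on_def)
  qed
  moreover have "dom ((Some \<circ> f) |` D) = D" by (auto simp: restrict_map_def dom_def)
  ultimately show ?thesis by (simp only: local_diffeo_def)
qed

lemma local_diffeo_Some:
  assumes A: "smooth_atlas A"
  shows "local_diffeo A Some"
proof -
  have "smooth_map_on A UNIV (\<lambda>z. z)"
    unfolding smooth_map_on_def using smooth_atlas_change[OF A] by (auto simp: o_def)
  then have "diffeo_on A UNIV (\<lambda>z. z)" by (intro diffeo_onI[OF A, where g = "\<lambda>z. z"]) auto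
  then show ?thesis by (simp add: local_diffeo_def dom_def)
qed

section \<open>Derivatives in charts\<close>

lemma diffeo_smooth: "diffeo A f \<Longrightarrow> smooth_map_on A D f"
  unfolding diffeo_def diffeo_on_def using smooth_map_on_subset by blast

lemma diffeo_continuous: "diffeo A f \<Longrightarrow> continuous_on D f"
  using diffeo_smooth unfolding smooth_map_on_def by blast

lemma inj_derivative_of_left_inverse:
  assumes h: "(h has_derivative h') (at z)" and k: "(k has_derivative k') (at (h z))"
    and S: "open S" "z \<in> S" "\<And>y. y \<in> S \<Longrightarrow> k (h y) = y"
  shows "k' (h' v) = v"
proof -
  have "(k \<circ> h has_derivative k' \<circ> h') (at z)" by (rule diff_chain_at[OF h k])
  then have "((\<lambda>y. y) has_derivative k' \<circ> h') (at z)"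
    by (rule has_derivative_transform_within_open[OF _ S(1,2)]) (simp add: S(3))
  then have "k' \<circ> h' = (\<lambda>v. v)" using has_derivative_unique has_derivative_ident by blast
  then show ?thesis by (metis comp_apply)
qed

lemma coord_smooth_has_derivative:
  assumes A: "smooth_atlas A" and U: "(U, \<alpha>) \<in> A" "p \<in> U" "p \<in> D" and f: "coord_smooth A D f"
  shows "((f \<circ> inv_into U \<alpha>) has_derivative frechet_derivative (f \<circ> inv_into U \<alpha>) (at (\<alpha> p))) (at (\<alpha> p))"
  by (rule smooth_on_has_derivative[OF coord_smoothD[OF f U(1)]]) (use U in blast)

text \<open>
  Smoothness is defined through the charts of \<open>A\<close>, but it can be tested in any compatible chart:
  near a point of a chart \<open>\<beta>\<close> of \<open>A\<close>, \<open>f \<circ> \<gamma>\<^sup>-\<^sup>1 = (f \<circ> \<beta>\<^sup>-\<^sup>1) \<circ> (\<beta> \<circ> \<gamma>\<^sup>-\<^sup>1)\<close>.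
\<close>

lemma coord_smooth_in_compatible_chart:
  assumes A: "smooth_atlas A" and N: "compatible_chart A (N, \<gamma>)" and D: "open D" and f: "coord_smooth A D f"
  shows "smooth_on (\<gamma> ` (N \<inter> D)) (f \<circ> inv_into N \<gamma>)"
proof (rule smooth_on_local)
  have n: "is_chart (N, \<gamma>)" using N by (simp add: compatible_chart_def)
  fix z assume "z \<in> \<gamma> ` (N \<inter> D)"
  then obtain p where p: "p \<in> N" "p \<in> D" "z = \<gamma> p" by blast
  obtain W \<beta> where W: "(W, \<beta>) \<in> A" "p \<in> W" using smooth_atlas_cover[OF A] .
  have d: "is_chart (W, \<beta>)" using smooth_atlas_chart[OF A W(1)] .
  let ?T = "\<gamma> ` (N \<inter> D \<inter> W)"
  have "open (N \<inter> D \<inter> W)" using is_chart_open[OF n] D is_chart_open[OF d] by blast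
  then have op1: "open ?T" by (intro is_chart_open_image[OF n]) auto
  have op2: "open (\<beta> ` (W \<inter> D))"
    using is_chart_open_image[OF d] is_chart_open[OF d] D by blast
  have "smooth_on ?T (\<beta> \<circ> inv_into N \<gamma>)"
    using N W(1) unfolding compatible_chart_def by (fast intro: smooth_on_subset)
  then have "smooth_on ?T ((f \<circ> inv_into W \<beta>) \<circ> (\<beta> \<circ> inv_into N \<gamma>))"
    by (rule smooth_on_compose[OF op1 op2 _ coord_smoothD[OF f W(1)]])
      (auto simp: is_chart_inv[OF n])
  moreover have "\<forall>y\<in>?T. (f \<circ> inv_into N \<gamma>) y = ((f \<circ> inv_into W \<beta>) \<circ> (\<beta> \<circ> inv_into N \<gamma>)) y"
    by (auto simp: is_chart_inv[OF n] is_chart_inv[OF d])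
  ultimately show "\<exists>T g. open T \<and> z \<in> T \<and> smooth_on T g \<and> (\<forall>y\<in>T. (f \<circ> inv_into N \<gamma>) y = g y)"
    using op1 p W(2) by blast
qed

text \<open>
  The map \<open>\<gamma> \<circ> \<phi> \<circ> \<alpha>\<^sup>-\<^sup>1\<close> has the smooth left inverse \<open>\<alpha> \<circ> \<phi>\<^sup>-\<^sup>1 \<circ> \<gamma>\<^sup>-\<^sup>1\<close>.
\<close>

lemma inj_derivative_chart_diffeo:
  assumes A: "smooth_atlas A" and N: "compatible_chart A (N, \<gamma>)" and \<phi>: "diffeo A \<phi>"
    and U: "(U, \<alpha>) \<in> A" "x \<in> U" and x: "\<phi> x \<in> N"
  shows "inj (frechet_derivative (\<gamma> \<circ> \<phi> \<circ> inv_into U \<alpha>) (at (\<alpha> x)))"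
proof -
  have c: "is_chart (U, \<alpha>)" using smooth_atlas_chart[OF A U(1)] .
  have n: "is_chart (N, \<gamma>)" and s: "coord_smooth A N \<gamma>" using N by (simp_all add: compatible_chart_def)
  have \<phi>': "inj \<phi>" "smooth_map_on A UNIV (inv \<phi>)" using \<phi> by (auto simp: diffeo_def diffeo_on_def)
  have opD: "open (\<phi> -` N)"
    using continuous_open_preimage[OF diffeo_continuous[OF \<phi>] open_UNIV is_chart_open[OF n]] by simp
  have sm: "coord_smooth A (\<phi> -` N) (\<gamma> \<circ> \<phi>)"
    by (rule coord_smooth_compose[OF A opD is_chart_open[OF n] _ diffeo_smooth[OF \<phi>] s]) auto
  let ?h = "\<gamma> \<circ> \<phi> \<circ> inv_into U \<alpha>" and ?k = "(\<alpha> \<circ> inv \<phi>) \<circ> inv_into N \<gamma>"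
  have h: "(?h has_derivative frechet_derivative ?h (at (\<alpha> x))) (at (\<alpha> x))"
    by (rule coord_smooth_has_derivative[OF A U _ sm]) (use x in simp)
  have op': "open (inv \<phi> -` U)"
    using continuous_open_preimage[OF _ open_UNIV is_chart_open[OF c], of "inv \<phi>"] \<phi>'(2)
    by (simp add: smooth_map_on_def)
  have "coord_smooth A (inv \<phi> -` U) (\<alpha> \<circ> inv \<phi>)"
    using \<phi>'(2) U(1) unfolding smooth_map_on_iff by auto
  then have "smooth_on (\<gamma> ` (N \<inter> inv \<phi> -` U)) ?k"
    by (rule coord_smooth_in_compatible_chart[OF A N op'])
  moreover have "?h (\<alpha> x) \<in> \<gamma> ` (N \<inter> inv \<phi> -` U)"
    using x U(2) \<phi>'(1) by (auto simp: is_chart_inv[OF c])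
  ultimately have k: "(?k has_derivative frechet_derivative ?k (at (?h (\<alpha> x)))) (at (?h (\<alpha> x)))"
    by (rule smooth_on_has_derivative)
  have "open (U \<inter> \<phi> -` N)" using opD is_chart_open[OF c] by blast
  then have "open (\<alpha> ` (U \<inter> \<phi> -` N))" by (intro is_chart_open_image[OF c]) auto
  from inj_derivative_of_left_inverse[OF h k this]
  have "frechet_derivative ?k (at (?h (\<alpha> x))) (frechet_derivative ?h (at (\<alpha> x)) v) = v" for v
    using U(2) x \<phi>'(1) by (force simp: is_chart_inv[OF c] is_chart_inv[OF n])
  then show ?thesis by (rule inj_on_inverseI)
qed

lemma frechet_derivative_in_chart:
  assumes A: "smooth_atlas A" and f: "smooth_map_on A UNIV f"
    and U: "(U, \<alpha>) \<in> A" "x \<in> U" and W: "(W, \<beta>) \<in> A" "f x \<in> W"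
    and D: "open D" "f x \<in> D" and g: "coord_smooth A D g"
  shows "frechet_derivative (g \<circ> f \<circ> inv_into U \<alpha>) (at (\<alpha> x)) v =
    (\<Sum>b\<in>Basis. (frechet_derivative (\<beta> \<circ> f \<circ> inv_into U \<alpha>) (at (\<alpha> x)) v \<bullet> b) *\<^sub>R
       frechet_derivative (g \<circ> inv_into W \<beta>) (at (\<beta> (f x))) b)"
proof -
  have c: "is_chart (U, \<alpha>)" and d: "is_chart (W, \<beta>)" using smooth_atlas_chart[OF A] U(1) W(1) by auto
  let ?h = "\<beta> \<circ> f \<circ> inv_into U \<alpha>" and ?g = "g \<circ> inv_into W \<beta>"
  have "open (U \<inter> f -` W)"
    using continuous_open_preimage[OF _ open_UNIV is_chart_open[OF d], of f] f is_chart_open[OF c]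
    by (auto simp: smooth_map_on_def)
  then have op: "open (\<alpha> ` (U \<inter> f -` W))" by (intro is_chart_open_image[OF c]) auto
  have "coord_smooth A (f -` W) (\<beta> \<circ> f)" using f W(1) unfolding smooth_map_on_iff by auto
  then have h: "(?h has_derivative frechet_derivative ?h (at (\<alpha> x))) (at (\<alpha> x))"
    by (rule coord_smooth_has_derivative[OF A U, rotated]) (use W in simp)
  have hx: "?h (\<alpha> x) = \<beta> (f x)" using U(2) by (simp add: is_chart_inv[OF c])
  have g': "(?g has_derivative frechet_derivative ?g (at (\<beta> (f x)))) (at (\<beta> (f x)))"
    by (rule coord_smooth_has_derivative[OF A W D(2) g])
  have "(?g \<circ> ?h has_derivative frechet_derivative ?g (at (\<beta> (f x))) \<circ> frechet_derivative ?h (at (\<alpha> x))) (at (\<alpha> x))"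
    using diff_chain_at[OF h, unfolded hx, OF g'] .
  then have "(g \<circ> f \<circ> inv_into U \<alpha> has_derivative
      frechet_derivative ?g (at (\<beta> (f x))) \<circ> frechet_derivative ?h (at (\<alpha> x))) (at (\<alpha> x))"
    by (rule has_derivative_transform_within_open[OF _ op])
      (use U(2) W(2) in \<open>auto simp: is_chart_inv[OF c] is_chart_inv[OF d]\<close>)
  from fun_cong[OF frechet_derivative_at[OF this], of v, symmetric]
  have "frechet_derivative (g \<circ> f \<circ> inv_into U \<alpha>) (at (\<alpha> x)) v =
    frechet_derivative ?g (at (\<beta> (f x))) (frechet_derivative ?h (at (\<alpha> x)) v)"
    by (simp only: comp_apply)
  also have "\<dots> = (\<Sum>b\<in>Basis. (frechet_derivative ?h (at (\<alpha> x)) v \<bullet> b) *\<^sub>R frechet_derivative ?g (at (\<beta> (f x))) b)"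
    by (rule linear_eq_sum_Basis[OF has_derivative_linear[OF g']])
  finally show ?thesis .
qed

text \<open>
  Taking \<open>K = {x}\<close> and lists of length at most one in the definition of continuity gives the claims
  for a chart of \<open>A\<close> around \<open>\<phi> t0 x\<close>; the chain rule extends them to smooth functions \<open>g\<close>. The lemma
  is meant for \<open>g\<close> a biregular chart, which need not belong to \<open>A\<close>.
\<close>

lemma smoothly_continuous_in_coordinates:
  assumes A: "smooth_atlas A" and \<phi>: "smoothly_continuous_on A I \<phi>" "\<And>t. t \<in> I \<Longrightarrow> diffeo A (\<phi> t)"
    and t0: "t0 \<in> I" and U: "(U, \<alpha>) \<in> A" "x \<in> U"
    and D: "open D" "\<phi> t0 x \<in> D" and g: "coord_smooth A D g"
  shows "\<forall>\<^sub>F t in at t0 within I. \<phi> t x \<in> D"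
    and "((\<lambda>t. g (\<phi> t x)) \<longlongrightarrow> g (\<phi> t0 x)) (at t0 within I)"
    and "((\<lambda>t. frechet_derivative (g \<circ> \<phi> t \<circ> inv_into U \<alpha>) (at (\<alpha> x)) v) \<longlongrightarrow>
           frechet_derivative (g \<circ> \<phi> t0 \<circ> inv_into U \<alpha>) (at (\<alpha> x)) v) (at t0 within I)"
proof -
  let ?F = "at t0 within I"
  have c: "is_chart (U, \<alpha>)" using smooth_atlas_chart[OF A U(1)] .
  obtain W \<beta> where W: "(W, \<beta>) \<in> A" "\<phi> t0 x \<in> W" using smooth_atlas_cover[OF A] .
  have d: "is_chart (W, \<beta>)" using smooth_atlas_chart[OF A W(1)] .
  have evW: "\<forall>\<^sub>F t in ?F. \<phi> t x \<in> W"
    and lim: "uniform_limit (\<alpha> ` {x}) (\<lambda>t. iter_deriv vs (\<beta> \<circ> \<phi> t \<circ> inv_into U \<alpha>))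
           (iter_deriv vs (\<beta> \<circ> \<phi> t0 \<circ> inv_into U \<alpha>)) ?F" for vs
  proof -
    have K: "compact {x} \<and> {x} \<subseteq> U \<and> \<phi> t0 ` {x} \<subseteq> W" using U(2) W(2) by simp
    note UW = bspec[OF bspec[OF \<phi>(1)[unfolded smoothly_continuous_on_def] U(1), unfolded prod.case] W(1),
        unfolded prod.case]
    have *: "(\<forall>\<^sub>F t in ?F. \<phi> t ` {x} \<subseteq> W) \<and>
        (\<forall>vs. uniform_limit (\<alpha> ` {x}) (\<lambda>t. iter_deriv vs (\<beta> \<circ> \<phi> t \<circ> inv_into U \<alpha>))
           (iter_deriv vs (\<beta> \<circ> \<phi> t0 \<circ> inv_into U \<alpha>)) ?F)"
      using bspec[OF spec[OF UW] t0] K by (rule mp)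
    then show "\<forall>\<^sub>F t in ?F. \<phi> t x \<in> W" by simp
    show "uniform_limit (\<alpha> ` {x}) (\<lambda>t. iter_deriv vs (\<beta> \<circ> \<phi> t \<circ> inv_into U \<alpha>))
           (iter_deriv vs (\<beta> \<circ> \<phi> t0 \<circ> inv_into U \<alpha>)) ?F" using * by blast
  qed
  have limP: "((\<lambda>t. \<beta> (\<phi> t x)) \<longlongrightarrow> \<beta> (\<phi> t0 x)) ?F"
    using tendsto_uniform_limitI[OF lim[of "[]"], of "\<alpha> x"] U(2) by (simp add: is_chart_inv[OF c])
  have limD: "((\<lambda>t. frechet_derivative (\<beta> \<circ> \<phi> t \<circ> inv_into U \<alpha>) (at (\<alpha> x)) v) \<longlongrightarrow>
        frechet_derivative (\<beta> \<circ> \<phi> t0 \<circ> inv_into U \<alpha>) (at (\<alpha> x)) v) ?F" for v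
    using tendsto_uniform_limitI[OF lim[of "[v]"], of "\<alpha> x"] by simp
  have op: "open (\<beta> ` (W \<inter> D))"
    using is_chart_open_image[OF d] is_chart_open[OF d] D(1) by blast
  have in0: "\<beta> (\<phi> t0 x) \<in> \<beta> ` (W \<inter> D)" using W(2) D(2) by blast
  have "\<forall>\<^sub>F t in ?F. \<beta> (\<phi> t x) \<in> \<beta> ` (W \<inter> D)" by (rule topological_tendstoD[OF limP op in0])
  with evW have evWD: "\<forall>\<^sub>F t in ?F. \<phi> t x \<in> W \<inter> D"
  proof eventually_elim
    case (elim t)
    then show ?case using is_chart_inj[OF d] by (auto dest: inj_onD)
  qed
  then show "\<forall>\<^sub>F t in ?F. \<phi> t x \<in> D" by (rule eventually_mono) auto
  have sm: "smooth_on (\<beta> ` (W \<inter> D)) (g \<circ> inv_into W \<beta>)" by (rule coord_smoothD[OF g W(1)])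
  have "((\<lambda>t. (g \<circ> inv_into W \<beta>) (\<beta> (\<phi> t x))) \<longlongrightarrow> (g \<circ> inv_into W \<beta>) (\<beta> (\<phi> t0 x))) ?F"
    by (rule isCont_tendsto_compose[OF smooth_on_isCont[OF sm in0] limP])
  then have "((\<lambda>t. (g \<circ> inv_into W \<beta>) (\<beta> (\<phi> t x))) \<longlongrightarrow> g (\<phi> t0 x)) ?F"
    using W(2) by (simp add: is_chart_inv[OF d])
  then show "((\<lambda>t. g (\<phi> t x)) \<longlongrightarrow> g (\<phi> t0 x)) ?F"
    by (rule Lim_transform_eventually)
      (use evWD in \<open>auto elim!: eventually_mono simp: is_chart_inv[OF d]\<close>)
  let ?R = "\<lambda>t. \<Sum>b\<in>Basis. (frechet_derivative (\<beta> \<circ> \<phi> t \<circ> inv_into U \<alpha>) (at (\<alpha> x)) v \<bullet> b) *\<^sub>R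
       frechet_derivative (g \<circ> inv_into W \<beta>) (at (\<beta> (\<phi> t x))) b"
  have R: "frechet_derivative (g \<circ> \<phi> t \<circ> inv_into U \<alpha>) (at (\<alpha> x)) v = ?R t"
    if "t \<in> I" "\<phi> t x \<in> W" "\<phi> t x \<in> D" for t
    by (rule frechet_derivative_in_chart[OF A diffeo_smooth[OF \<phi>(2)[OF that(1)]] U W(1) that(2) D(1) that(3) g])
  have "(?R \<longlongrightarrow> ?R t0) ?F"
    by (intro tendsto_sum tendsto_scaleR tendsto_inner limD tendsto_const
        isCont_tendsto_compose[OF smooth_on_isCont[OF smooth_on_deriv[OF sm] in0] limP])
  then have "(?R \<longlongrightarrow> frechet_derivative (g \<circ> \<phi> t0 \<circ> inv_into U \<alpha>) (at (\<alpha> x)) v) ?F"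
    using R[OF t0 W(2) D(2)] by simp
  moreover have "\<forall>\<^sub>F t in ?F. t \<in> I" by (simp add: eventually_at_filter)
  with evWD have "\<forall>\<^sub>F t in ?F. ?R t = frechet_derivative (g \<circ> \<phi> t \<circ> inv_into U \<alpha>) (at (\<alpha> x)) v"
  proof eventually_elim
    case (elim t)
    then show ?case using R[of t] by simp
  qed
  ultimately show "((\<lambda>t. frechet_derivative (g \<circ> \<phi> t \<circ> inv_into U \<alpha>) (at (\<alpha> x)) v) \<longlongrightarrow>
           frechet_derivative (g \<circ> \<phi> t0 \<circ> inv_into U \<alpha>) (at (\<alpha> x)) v) ?F"
    by (rule Lim_transform_eventually)
qed

section \<open>The local decomposition\<close>

lemma plaque_subset_leaf:
  "(U, \<alpha>) \<in> F \<Longrightarrow> p \<in> U \<Longrightarrow> q \<in> U \<Longrightarrow> \<tau> (\<alpha> p) = \<tau> (\<alpha> q) \<Longrightarrow> q \<in> leaf \<tau> F p"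
  unfolding leaf_def same_plaque_def by (intro CollectI r_into_rtranclp) blast

lemma foliation_cover:
  assumes "foliation A \<tau> F" obtains U \<alpha> where "(U, \<alpha>) \<in> F" "p \<in> U"
proof -
  have "p \<in> (\<Union>c\<in>F. fst c)" using assms unfolding foliation_def by simp
  then show thesis using that by force
qed

lemma foliation_compatible_chart:
  assumes "foliation A \<tau> F" "(U, \<alpha>) \<in> F"
  shows "compatible_chart A (U, \<alpha>)"
proof (rule compatible_chartI)
  show "smooth_atlas (A \<union> F)" using assms(1) unfolding foliation_def by (rule conjunct1)
qed (use assms(2) in simp)

text \<open>
  The kernel of the differential of a transverse coordinate is tangent to the leaf: apply the
  differentials of the transition map to the foliated chart and back.
\<close>

lemma derivative_preimage_in_leaf_tangent:
  assumes A: "smooth_atlas A" and F: "compatible_chart A (U, \<alpha>)" "(U, \<alpha>) \<in> F" "p \<in> U"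
    and W: "(W, \<beta>) \<in> A" "p \<in> W"
    and u: "\<tau> (frechet_derivative (\<alpha> \<circ> inv_into W \<beta>) (at (\<beta> p)) u) = 0"
  shows "u \<in> leaf_tangent \<tau> F \<beta> p"
proof -
  have c: "is_chart (U, \<alpha>)" and s: "coord_smooth A U \<alpha>" using F(1) by (simp_all add: compatible_chart_def)
  have d: "is_chart (W, \<beta>)" using smooth_atlas_chart[OF A W(1)] .
  let ?h = "\<alpha> \<circ> inv_into W \<beta>" and ?k = "\<beta> \<circ> inv_into U \<alpha>"
  have hp: "?h (\<beta> p) = \<alpha> p" using W(2) by (simp add: is_chart_inv[OF d])
  have h: "(?h has_derivative frechet_derivative ?h (at (\<beta> p))) (at (\<beta> p))"
    by (rule coord_smooth_has_derivative[OF A W F(3) s])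
  have "smooth_on (\<alpha> ` (U \<inter> W)) ?k" using F(1) W(1) unfolding compatible_chart_def by blast
  then have k: "(?k has_derivative frechet_derivative ?k (at (\<alpha> p))) (at (?h (\<beta> p)))"
    unfolding hp by (rule smooth_on_has_derivative) (use F(3) W(2) in blast)
  have "open (\<beta> ` (W \<inter> U))"
    using is_chart_open_image[OF d] is_chart_open[OF c] is_chart_open[OF d] by blast
  from inj_derivative_of_left_inverse[OF h k this]
  have "frechet_derivative ?k (at (\<alpha> p)) (frechet_derivative ?h (at (\<beta> p)) u) = u"
    using F(3) W(2) by (force simp: is_chart_inv[OF c] is_chart_inv[OF d])
  then show ?thesis unfolding leaf_tangent_def using F(2,3) u
    by (intro CollectI exI[of _ U] exI[of _ \<alpha>] exI[of _ "frechet_derivative ?h (at (\<beta> p)) u"]) simp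
qed

text \<open>
  The transverse coordinate \<open>fst \<circ> \<alpha>V\<close> of \<open>V\<close> and the transverse coordinate \<open>snd \<circ> \<alpha>H\<close> of \<open>H\<close> together
  form a chart. A vector in the kernel of both differentials is tangent to the leaves of both
  foliations, hence zero by complementarity.
\<close>

lemma biregular_chart:
  fixes A H V :: "('a::topological_space, 'x::euclidean_space \<times> 'y::euclidean_space) chart set"
  assumes A: "smooth_atlas A" and H: "foliation A snd H" and V: "foliation A fst V"
    and HV: "complementary A H V"
  obtains UH \<alpha>H UV \<alpha>V N where "(UH, \<alpha>H) \<in> H" "(UV, \<alpha>V) \<in> V" "p \<in> N" "N \<subseteq> UH" "N \<subseteq> UV"
    "compatible_chart A (N, \<lambda>z. (fst (\<alpha>V z), snd (\<alpha>H z)))"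
proof -
  obtain UH \<alpha>H where UH: "(UH, \<alpha>H) \<in> H" "p \<in> UH" using foliation_cover[OF H] .
  obtain UV \<alpha>V where UV: "(UV, \<alpha>V) \<in> V" "p \<in> UV" using foliation_cover[OF V] .
  obtain W \<beta> where W: "(W, \<beta>) \<in> A" "p \<in> W" using smooth_atlas_cover[OF A] .
  have cH: "compatible_chart A (UH, \<alpha>H)" and cV: "compatible_chart A (UV, \<alpha>V)"
    using foliation_compatible_chart[OF H UH(1)] foliation_compatible_chart[OF V UV(1)] .
  have s: "coord_smooth A UH \<alpha>H" "coord_smooth A UV \<alpha>V" and op: "open UH" "open UV"
    using cH cV is_chart_open by (auto simp: compatible_chart_def)
  let ?D = "UH \<inter> UV" and ?\<gamma> = "\<lambda>z. (fst (\<alpha>V z), snd (\<alpha>H z))"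
  have opD: "open ?D" using op by blast
  have sD: "coord_smooth A ?D \<alpha>H" "coord_smooth A ?D \<alpha>V" using s by (auto intro: coord_smooth_subset)
  have sm: "coord_smooth A ?D ?\<gamma>"
    by (intro coord_smooth_Pair[OF A opD] coord_smooth_linear[OF A opD bounded_linear_fst sD(2)]
        coord_smooth_linear[OF A opD bounded_linear_snd sD(1)])
  let ?h = "\<lambda>\<alpha>. frechet_derivative (\<alpha> \<circ> inv_into W \<beta>) (at (\<beta> p))"
  have h: "((\<alpha>H \<circ> inv_into W \<beta>) has_derivative ?h \<alpha>H) (at (\<beta> p))"
    "((\<alpha>V \<circ> inv_into W \<beta>) has_derivative ?h \<alpha>V) (at (\<beta> p))"
    using UH(2) UV(2) by (auto intro: coord_smooth_has_derivative[OF A W] sD)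
  have "((\<lambda>y. (fst ((\<alpha>V \<circ> inv_into W \<beta>) y), snd ((\<alpha>H \<circ> inv_into W \<beta>) y)))
      has_derivative (\<lambda>u. (fst (?h \<alpha>V u), snd (?h \<alpha>H u)))) (at (\<beta> p))"
    by (intro has_derivative_Pair has_derivative_fst has_derivative_snd h)
  then have d: "(?\<gamma> \<circ> inv_into W \<beta> has_derivative (\<lambda>u. (fst (?h \<alpha>V u), snd (?h \<alpha>H u)))) (at (\<beta> p))"
    by (simp add: o_def)
  have "u = 0" if "(fst (?h \<alpha>V u), snd (?h \<alpha>H u)) = 0" for u
  proof -
    have z: "fst (?h \<alpha>V u) = 0" "snd (?h \<alpha>H u) = 0" using that by (simp_all add: zero_prod_def)
    have "u \<in> leaf_tangent snd H \<beta> p \<inter> leaf_tangent fst V \<beta> p"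
      using derivative_preimage_in_leaf_tangent[where \<tau> = snd, OF A cH UH W z(2)]
        derivative_preimage_in_leaf_tangent[where \<tau> = fst, OF A cV UV W z(1)] by blast
    then show "u = 0" using HV W unfolding complementary_def by fast
  qed
  then have "inj (\<lambda>u. (fst (?h \<alpha>V u), snd (?h \<alpha>H u)))"
    using linear_injective_0[OF has_derivative_linear[OF d]] by blast
  then have inj: "inj (frechet_derivative (?\<gamma> \<circ> inv_into W \<beta>) (at (\<beta> p)))"
    using frechet_derivative_at[OF d] by simp
  obtain N where "p \<in> N" "N \<subseteq> ?D" "compatible_chart A (N, ?\<gamma>)"
    by (rule compatible_chart_of_injective_derivative[OF A W opD _ sm inj]) (use UH(2) UV(2) in auto)
  then show thesis using that UH(1) UV(1) by blast
qed

text \<open>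
  Keeping \<open>f\<close> on the right, instead of decomposing \<open>g \<circ> f\<^sup>-\<^sup>1\<close>, lets all
  neighbourhoods be neighbourhoods of the same point \<open>x\<close>.
\<close>

definition foliated_step ::
  "('a::topological_space, 'x::euclidean_space \<times> 'y::euclidean_space) chart set \<Rightarrow>
   ('a, 'x \<times> 'y) chart set \<Rightarrow> ('a, 'x \<times> 'y) chart set \<Rightarrow> 'a \<Rightarrow> ('a \<Rightarrow> 'a) \<Rightarrow> ('a \<Rightarrow> 'a) \<Rightarrow>
   ('a \<rightharpoonup> 'a) \<Rightarrow> ('a \<rightharpoonup> 'a) \<Rightarrow> 'a set \<Rightarrow> bool" where
  "foliated_step A H V x f g \<eta> \<psi> N \<longleftrightarrow>
     local_diffeo A \<eta> \<and> horizontal H \<eta> \<and> local_diffeo A \<psi> \<and> vertical V \<psi> \<and>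
     open N \<and> x \<in> N \<and> (\<forall>z\<in>N. (\<eta> \<circ>\<^sub>m \<psi>) (f z) = Some (g z))"

lemma foliated_step_refl:
  assumes "smooth_atlas A" shows "foliated_step A H V x f f Some Some UNIV"
  using local_diffeo_Some[OF assms]
  by (simp add: foliated_step_def horizontal_def vertical_def leaf_def map_comp_def)

text \<open>
  Let \<open>\<theta> z\<close> be the point whose first biregular coordinate is that of \<open>f z\<close> and whose second one is
  that of \<open>g z\<close>. The hypotheses say that \<open>\<theta> x\<close> exists and that \<open>\<theta>\<close> is a local diffeomorphism at \<open>x\<close>.
  Then \<open>\<psi> = \<theta> \<circ> f\<^sup>-\<^sup>1\<close> fixes the first coordinate, so it moves points within vertical plaques, and
  \<open>\<eta> = g \<circ> \<theta>\<^sup>-\<^sup>1\<close> fixes the second one, so it moves points within horizontal plaques; clearly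
  \<open>\<eta> \<circ> \<psi> \<circ> f = g\<close>.
\<close>

lemma foliated_step_exists:
  assumes A: "smooth_atlas A" and H: "(UH, \<alpha>H) \<in> H" and V: "(UV, \<alpha>V) \<in> V"
    and N: "N \<subseteq> UH" "N \<subseteq> UV" "compatible_chart A (N, \<gamma>)"
    and \<gamma>: "\<gamma> = (\<lambda>z. (fst (\<alpha>V z), snd (\<alpha>H z)))"
    and f: "diffeo A f" "f x \<in> N" and g: "diffeo A g" "g x \<in> N"
    and fg: "(fst (\<gamma> (f x)), snd (\<gamma> (g x))) \<in> \<gamma> ` N"
    and U: "(U, \<alpha>) \<in> A" "x \<in> U"
    and inj: "inj (\<lambda>v. (fst (frechet_derivative (\<gamma> \<circ> f \<circ> inv_into U \<alpha>) (at (\<alpha> x)) v),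
                        snd (frechet_derivative (\<gamma> \<circ> g \<circ> inv_into U \<alpha>) (at (\<alpha> x)) v)))"
  shows "\<exists>\<eta> \<psi> M. foliated_step A H V x f g \<eta> \<psi> M"
proof -
  have n: "is_chart (N, \<gamma>)" and s: "coord_smooth A N \<gamma>" using N(3) by (simp_all add: compatible_chart_def)
  let ?D = "f -` N \<inter> g -` N"
  have "open (f -` N)" "open (g -` N)"
    using continuous_open_preimage[OF diffeo_continuous[OF f(1)] open_UNIV is_chart_open[OF n]]
      continuous_open_preimage[OF diffeo_continuous[OF g(1)] open_UNIV is_chart_open[OF n]] by simp_all
  then have opD: "open ?D" by blast
  have sf: "coord_smooth A ?D (\<gamma> \<circ> f)"
    by (rule coord_smooth_compose[OF A opD is_chart_open[OF n] _ diffeo_smooth[OF f(1)] s]) auto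
  have sg: "coord_smooth A ?D (\<gamma> \<circ> g)"
    by (rule coord_smooth_compose[OF A opD is_chart_open[OF n] _ diffeo_smooth[OF g(1)] s]) auto
  let ?F = "\<lambda>z. (fst ((\<gamma> \<circ> f) z), snd ((\<gamma> \<circ> g) z))"
  have sF: "coord_smooth A ?D ?F"
    by (intro coord_smooth_Pair[OF A opD] coord_smooth_linear[OF A opD bounded_linear_fst sf]
        coord_smooth_linear[OF A opD bounded_linear_snd sg])
  let ?D' = "?D \<inter> ?F -` (\<gamma> ` N)"
  have opD': "open ?D'"
    by (rule continuous_open_preimage[OF coord_smooth_continuous[OF A opD sF] opD]) (use n in \<open>simp add: is_chart_def\<close>)
  have xD: "x \<in> ?D" using f g by simp
  let ?h = "\<lambda>f. frechet_derivative (\<gamma> \<circ> f \<circ> inv_into U \<alpha>) (at (\<alpha> x))"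
  have h: "((\<gamma> \<circ> f \<circ> inv_into U \<alpha>) has_derivative ?h f) (at (\<alpha> x))"
    "((\<gamma> \<circ> g \<circ> inv_into U \<alpha>) has_derivative ?h g) (at (\<alpha> x))"
    using coord_smooth_has_derivative[OF A U xD sf] coord_smooth_has_derivative[OF A U xD sg] by auto
  have "((\<lambda>y. (fst ((\<gamma> \<circ> f \<circ> inv_into U \<alpha>) y), snd ((\<gamma> \<circ> g \<circ> inv_into U \<alpha>) y)))
      has_derivative (\<lambda>u. (fst (?h f u), snd (?h g u)))) (at (\<alpha> x))"
    by (intro has_derivative_Pair has_derivative_fst has_derivative_snd h)
  then have "(?F \<circ> inv_into U \<alpha> has_derivative (\<lambda>u. (fst (?h f u), snd (?h g u)))) (at (\<alpha> x))"
    by (simp add: o_def)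
  from frechet_derivative_at[OF this] inj
  have injF: "inj (frechet_derivative (?F \<circ> inv_into U \<alpha>) (at (\<alpha> x)))" by simp
  have xD': "x \<in> ?D'" using xD fg by simp
  have sF': "coord_smooth A ?D' ?F" using sF by (rule coord_smooth_subset) auto
  obtain M where M: "x \<in> M" "M \<subseteq> ?D'" "compatible_chart A (M, ?F)"
    by (rule compatible_chart_of_injective_derivative[OF A U opD' xD' sF' injF])
  have opM: "open M" using M(3) is_chart_open by (auto simp: compatible_chart_def)
  define \<theta> where "\<theta> = inv_into N \<gamma> \<circ> ?F"
  have sub: "?F ` M \<subseteq> \<gamma> ` N" using M(2) by blast
  have d\<theta>: "diffeo_on A M \<theta>"
    unfolding \<theta>_def by (rule diffeo_on_chart_transition[OF A N(3) M(3) sub])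
  have \<theta>: "\<theta> z \<in> N" "fst (\<alpha>V (\<theta> z)) = fst (\<alpha>V (f z))" "snd (\<alpha>H (\<theta> z)) = snd (\<alpha>H (g z))"
    "f z \<in> N" "g z \<in> N" if "z \<in> M" for z
  proof -
    have "?F z \<in> \<gamma> ` N" using M(2) that by blast
    then show "\<theta> z \<in> N" unfolding \<theta>_def by (simp add: inv_into_into)
    have "\<gamma> (\<theta> z) = ?F z" unfolding \<theta>_def using \<open>?F z \<in> \<gamma> ` N\<close> by (simp add: f_inv_into_f)
    then show "fst (\<alpha>V (\<theta> z)) = fst (\<alpha>V (f z))" "snd (\<alpha>H (\<theta> z)) = snd (\<alpha>H (g z))"
      by (simp_all add: \<gamma>)
    show "f z \<in> N" "g z \<in> N" using M(2) that by auto
  qed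
  have df: "diffeo_on A M f" and dg: "diffeo_on A M g"
    using diffeo_on_subset[OF A _ opM] f(1) g(1) unfolding diffeo_def by blast+
  have injM: "inj_on f M" "inj_on \<theta> M" using df d\<theta> by (simp_all add: diffeo_on_def)
  define \<psi> where "\<psi> = (Some \<circ> (\<theta> \<circ> inv_into M f)) |` (f ` M)"
  define \<eta> where "\<eta> = (Some \<circ> (g \<circ> inv_into M \<theta>)) |` (\<theta> ` M)"
  have \<psi>: "\<psi> (f z) = Some (\<theta> z)" and \<eta>: "\<eta> (\<theta> z) = Some (g z)" if "z \<in> M" for z
    using that injM by (simp_all add: \<psi>_def \<eta>_def)
  have "local_diffeo A \<psi>" unfolding \<psi>_def
    by (intro local_diffeo_restrict[OF A] diffeo_on_compose[OF A diffeo_on_inv_into[OF A df]])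
      (simp add: injM d\<theta>)
  moreover have "local_diffeo A \<eta>" unfolding \<eta>_def
    by (intro local_diffeo_restrict[OF A] diffeo_on_compose[OF A diffeo_on_inv_into[OF A d\<theta>]])
      (simp add: injM dg)
  moreover have "vertical V \<psi>"
    unfolding vertical_def
  proof (intro allI impI)
    fix p q assume pq: "\<psi> p = Some q"
    then have "p \<in> f ` M" unfolding \<psi>_def by (auto simp: restrict_map_def split: if_splits)
    then obtain z where z: "z \<in> M" "p = f z" by blast
    then have "q = \<theta> z" using pq \<psi> by simp
    then show "q \<in> leaf fst V p"
      using plaque_subset_leaf[OF V, of p q fst] N(2) \<theta>[OF z(1)] z(2) by auto
  qed
  moreover have "horizontal H \<eta>"
    unfolding horizontal_def
  proof (intro allI impI)
    fix p q assume pq: "\<eta> p = Some q"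
    then have "p \<in> \<theta> ` M" unfolding \<eta>_def by (auto simp: restrict_map_def split: if_splits)
    then obtain z where z: "z \<in> M" "p = \<theta> z" by blast
    then have "q = g z" using pq \<eta> by simp
    then show "q \<in> leaf snd H p"
      using plaque_subset_leaf[OF H, of p q snd] N(1) \<theta>[OF z(1)] z(2) by auto
  qed
  ultimately have "foliated_step A H V x f g \<eta> \<psi> M"
    unfolding foliated_step_def using opM M(1) \<psi> \<eta> by (simp add: map_comp_def)
  then show ?thesis by blast
qed

text \<open>
  For \<open>s = t = t0\<close> the differential in the previous lemma is the one of \<open>\<gamma> \<circ> \<phi> t0\<close>, which is injective,
  and the prescribed coordinates are those of \<open>\<phi> t0 x\<close>. Both conditions are open, so they persist
  for \<open>s\<close> and \<open>t\<close> near \<open>t0\<close>.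
\<close>

lemma foliated_step_nearby:
  fixes A H V :: "('a::topological_space, 'x::euclidean_space \<times> 'y::euclidean_space) chart set"
  assumes A: "smooth_atlas A" and H: "foliation A snd H" and V: "foliation A fst V"
    and HV: "complementary A H V"
    and \<phi>: "smoothly_continuous_on A I \<phi>" "\<And>t. t \<in> I \<Longrightarrow> diffeo A (\<phi> t)"
    and t0: "t0 \<in> I"
  shows "\<exists>\<delta>>0. \<forall>s\<in>I. \<forall>t\<in>I. \<bar>s - t0\<bar> < \<delta> \<longrightarrow> \<bar>t - t0\<bar> < \<delta> \<longrightarrow>
           (\<exists>\<eta> \<psi> M. foliated_step A H V x (\<phi> s) (\<phi> t) \<eta> \<psi> M)"
proof -
  obtain UH \<alpha>H UV \<alpha>V N where UH: "(UH, \<alpha>H) \<in> H" and UV: "(UV, \<alpha>V) \<in> V"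
    and N: "\<phi> t0 x \<in> N" "N \<subseteq> UH" "N \<subseteq> UV"
    and cN: "compatible_chart A (N, \<lambda>z. (fst (\<alpha>V z), snd (\<alpha>H z)))"
    using biregular_chart[OF A H V HV, of "\<phi> t0 x"] .
  define \<gamma> where "\<gamma> = (\<lambda>z. (fst (\<alpha>V z), snd (\<alpha>H z)))"
  have cN: "compatible_chart A (N, \<gamma>)" using cN by (simp add: \<gamma>_def)
  have n: "is_chart (N, \<gamma>)" and s: "coord_smooth A N \<gamma>" using cN by (simp_all add: compatible_chart_def)
  obtain U \<alpha> where U: "(U, \<alpha>) \<in> A" "x \<in> U" using smooth_atlas_cover[OF A] .
  define L where "L = (\<lambda>t. frechet_derivative (\<gamma> \<circ> \<phi> t \<circ> inv_into U \<alpha>) (at (\<alpha> x)))"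
  have lin: "linear (L t)" if "t \<in> I" "\<phi> t x \<in> N" for t
  proof -
    have op: "open (\<phi> t -` N)"
      using continuous_open_preimage[OF diffeo_continuous[OF \<phi>(2)[OF that(1)]] open_UNIV is_chart_open[OF n]] by simp
    have "coord_smooth A (\<phi> t -` N) (\<gamma> \<circ> \<phi> t)"
      by (rule coord_smooth_compose[OF A op is_chart_open[OF n] _ diffeo_smooth[OF \<phi>(2)[OF that(1)]] s]) auto
    from coord_smooth_has_derivative[OF A U _ this] show ?thesis
      unfolding L_def using has_derivative_linear that(2) by blast
  qed
  have "inj (L t0)"
    unfolding L_def by (rule inj_derivative_chart_diffeo[OF A cN \<phi>(2)[OF t0] U N(1)])
  then obtain e where e: "e > 0"
    "\<And>M. linear M \<Longrightarrow> (\<And>b. b \<in> Basis \<Longrightarrow> norm (M b - L t0 b) < e) \<Longrightarrow> inj M"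
    using inj_linear_perturbation[OF lin[OF t0 N(1)]] by blast
  have "open (\<gamma> ` N)" "\<gamma> (\<phi> t0 x) \<in> \<gamma> ` N" using n N(1) by (simp_all add: is_chart_def)
  then obtain \<rho> where \<rho>: "\<rho> > 0" "ball (\<gamma> (\<phi> t0 x)) \<rho> \<subseteq> \<gamma> ` N" using openE by blast
  define near where "near = (\<lambda>t. \<phi> t x \<in> N \<and> norm (\<gamma> (\<phi> t x) - \<gamma> (\<phi> t0 x)) < \<rho> / 2 \<and>
    (\<forall>b\<in>Basis. norm (L t b - L t0 b) < e / 2))"
  note lim = smoothly_continuous_in_coordinates[OF A \<phi> t0 U is_chart_open[OF n] N(1) s]
  have "\<forall>\<^sub>F t in at t0 within I. near t"
    unfolding near_def
  proof (intro eventually_conj eventually_ball_finite ballI)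
    show "\<forall>\<^sub>F t in at t0 within I. \<phi> t x \<in> N" by (rule lim(1))
    show "\<forall>\<^sub>F t in at t0 within I. norm (\<gamma> (\<phi> t x) - \<gamma> (\<phi> t0 x)) < \<rho> / 2"
      using tendstoD[OF lim(2), of "\<rho> / 2"] \<rho>(1) by (simp add: dist_norm)
    show "\<forall>\<^sub>F t in at t0 within I. norm (L t b - L t0 b) < e / 2" for b
      using tendstoD[OF lim(3), of "e / 2"] e(1) by (simp add: dist_norm L_def)
  qed simp
  then obtain \<delta> where \<delta>: "\<delta> > 0" "\<forall>t\<in>I. t \<noteq> t0 \<and> dist t t0 < \<delta> \<longrightarrow> near t"
    unfolding eventually_at by blast
  moreover have "near t0" unfolding near_def using N(1) \<rho>(1) e(1) by simp
  ultimately have near: "near t" if "t \<in> I" "\<bar>t - t0\<bar> < \<delta>" for t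
    using that by (cases "t = t0") (auto simp: dist_real_def)
  \<comment> \<open>The two coordinates of the pair come from different times, so each error costs half of the margin.\<close>
  have split: "norm ((fst a, snd b) - c) < \<epsilon>" if "norm (a - c) < \<epsilon> / 2" "norm (b - c) < \<epsilon> / 2"
    for a b c :: "'x \<times> 'y" and \<epsilon>
  proof -
    have "(fst a, snd b) - c = (fst (a - c), snd (b - c))" by (simp add: prod_eq_iff)
    then have "norm ((fst a, snd b) - c) \<le> norm (fst (a - c)) + norm (snd (b - c))"
      using norm_Pair_le[of "fst (a - c)" "snd (b - c)"] by (simp only:)
    also have "\<dots> \<le> norm (a - c) + norm (b - c)"
      by (intro add_mono) (metis norm_fst_le prod.collapse, metis norm_snd_le prod.collapse)
    finally show ?thesis using that by linarith
  qed
  have "\<exists>\<eta> \<psi> M. foliated_step A H V x (\<phi> s) (\<phi> t) \<eta> \<psi> M"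
    if st: "s \<in> I" "t \<in> I" and "\<bar>s - t0\<bar> < \<delta>" "\<bar>t - t0\<bar> < \<delta>" for s t
  proof -
    have near: "near s" "near t" using that near by auto
    then have xN: "\<phi> s x \<in> N" "\<phi> t x \<in> N" by (auto simp: near_def)
    have "norm ((fst (\<gamma> (\<phi> s x)), snd (\<gamma> (\<phi> t x))) - \<gamma> (\<phi> t0 x)) < \<rho>"
      using near by (intro split) (auto simp: near_def)
    then have "(fst (\<gamma> (\<phi> s x)), snd (\<gamma> (\<phi> t x))) \<in> \<gamma> ` N"
      using \<rho>(2) by (auto simp: dist_norm norm_minus_commute)
    moreover have "inj (\<lambda>v. (fst (L s v), snd (L t v)))"
    proof (rule e(2))
      have "bounded_linear (L s)" "bounded_linear (L t)"
        using lin st xN by (simp_all add: linear_conv_bounded_linear)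
      then have "bounded_linear (\<lambda>v. (fst (L s v), snd (L t v)))"
        by (intro bounded_linear_Pair bounded_linear_fst_comp bounded_linear_snd_comp)
      then show "linear (\<lambda>v. (fst (L s v), snd (L t v)))" by (rule bounded_linear.linear)
      show "norm ((fst (L s b), snd (L t b)) - L t0 b) < e" if "b \<in> Basis" for b
        using near that by (intro split) (auto simp: near_def)
    qed
    ultimately show ?thesis
      using foliated_step_exists[OF A UH UV N(2,3) cN \<gamma>_def \<phi>(2)[OF st(1)] xN(1) \<phi>(2)[OF st(2)] xN(2) _ U]
      unfolding L_def by blast
  qed
  then show ?thesis using \<delta>(1) by blast
qed

section \<open>Partition of the time interval\<close>

text \<open>
  On each compact interval \<open>[0, n]\<close> there is a Lebesgue number \<open>E n\<close> below which steps satisfy \<open>R\<close>.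
  Starting from \<open>0\<close>, advance by the Lebesgue number of an interval that contains the current time.
  The times are unbounded because the steps made below a given bound take finitely many positive
  values. A finite
  \<open>T\<close> is treated together with \<open>T = \<infinity>\<close> by the retraction \<open>c\<close> of \<open>[0, \<infinity>)\<close> onto the time interval: it
  makes the partition constant once \<open>T\<close> is reached.
\<close>

lemma time_partition_exists:
  fixes T :: ereal and R :: "real \<Rightarrow> real \<Rightarrow> bool"
  assumes T: "0 < T"
    and R: "\<And>t0. t0 \<in> time_interval T \<Longrightarrow>
      \<exists>\<delta>>0. \<forall>s\<in>time_interval T. \<forall>t\<in>time_interval T. \<bar>s - t0\<bar> < \<delta> \<longrightarrow> \<bar>t - t0\<bar> < \<delta> \<longrightarrow> R s t"
  obtains r \<sigma> where "time_partition T r (\<lambda>k. ereal (\<sigma> k))" "mono \<sigma>"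
    "\<And>k t. \<sigma> k \<le> t \<Longrightarrow> t \<le> \<sigma> (Suc k) \<Longrightarrow> R (\<sigma> k) t"
    "\<And>t. t \<in> time_interval T \<Longrightarrow> \<exists>k. t \<le> \<sigma> k"
proof -
  define c where "c = (\<lambda>t. if T = \<infinity> then t else min t (real_of_ereal T))"
  have Tc: "T = \<infinity> \<or> (\<exists>b>0. T = ereal b)" using T by (cases T) auto
  have cI: "c t \<in> time_interval T" if "0 \<le> t" for t
    using that Tc by (auto simp: c_def time_interval_def)
  have c_id: "c t = t" if "t \<in> time_interval T" for t
    using that Tc by (auto simp: c_def time_interval_def)
  have c_lip: "\<bar>c s - c t\<bar> \<le> \<bar>s - t\<bar>" for s t by (auto simp: c_def)
  have c_mono: "c s \<le> c t" if "s \<le> t" for s t using that by (auto simp: c_def)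
  have c_le: "c t \<le> t" for t by (simp add: c_def)
  have "\<exists>e>0. \<forall>s t. 0 \<le> s \<longrightarrow> s \<le> real n \<longrightarrow> s \<le> t \<longrightarrow> t \<le> s + e \<longrightarrow> R (c s) (c t)" for n
  proof -
    have "\<exists>\<delta>>0. \<forall>s t. 0 \<le> s \<longrightarrow> 0 \<le> t \<longrightarrow> s \<in> ball u \<delta> \<longrightarrow> t \<in> ball u \<delta> \<longrightarrow> R (c s) (c t)"
      if "u \<in> {0..real n}" for u
    proof -
      have "c u \<in> time_interval T" using cI that by simp
      from R[OF this] obtain \<delta> where \<delta>: "\<delta> > 0" "\<forall>s\<in>time_interval T. \<forall>t\<in>time_interval T.
          \<bar>s - c u\<bar> < \<delta> \<longrightarrow> \<bar>t - c u\<bar> < \<delta> \<longrightarrow> R s t"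
        by blast
      have "R (c s) (c t)" if "0 \<le> s" "0 \<le> t" "s \<in> ball u \<delta>" "t \<in> ball u \<delta>" for s t
      proof -
        have "\<bar>c s - c u\<bar> < \<delta>" "\<bar>c t - c u\<bar> < \<delta>"
          using c_lip[of s u] c_lip[of t u] that(3,4) by (auto simp: dist_real_def)
        then show ?thesis using \<delta>(2) cI that(1,2) by blast
      qed
      then show ?thesis using \<delta>(1) by blast
    qed
    then obtain d where d: "\<And>u. u \<in> {0..real n} \<Longrightarrow> d u > 0 \<and>
        (\<forall>s t. 0 \<le> s \<longrightarrow> 0 \<le> t \<longrightarrow> s \<in> ball u (d u) \<longrightarrow> t \<in> ball u (d u) \<longrightarrow> R (c s) (c t))"
      by metis
    have cov: "{0..real n} \<subseteq> \<Union>((\<lambda>u. ball u (d u)) ` {0..real n})" using d by force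
    obtain e where e: "e > 0"
      "\<And>s. s \<in> {0..real n} \<Longrightarrow> \<exists>G \<in> (\<lambda>u. ball u (d u)) ` {0..real n}. ball s e \<subseteq> G"
      by (rule Heine_Borel_lemma[OF compact_Icc cov]) auto
    have "R (c s) (c t)" if "0 \<le> s" "s \<le> real n" "s \<le> t" "t \<le> s + e / 2" for s t
    proof -
      have "s \<in> {0..real n}" using that by simp
      from e(2)[OF this] obtain u where u: "u \<in> {0..real n}" "ball s e \<subseteq> ball u (d u)" by blast
      have "s \<in> ball s e" "t \<in> ball s e" using that e(1) by (auto simp: dist_real_def)
      then show ?thesis using d[OF u(1)] u(2) that by (meson order_trans subsetD)
    qed
    then show ?thesis using e(1) by (intro exI[of _ "e / 2"]) auto
  qed
  then obtain E where E: "\<And>n. E n > 0"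
    "\<And>n s t. 0 \<le> s \<Longrightarrow> s \<le> real n \<Longrightarrow> s \<le> t \<Longrightarrow> t \<le> s + E n \<Longrightarrow> R (c s) (c t)"
    by metis
  define \<tau> where "\<tau> = rec_nat 0 (\<lambda>_ u. u + E (nat \<lceil>u\<rceil>))"
  have \<tau>0: "\<tau> 0 = 0" and \<tau>S: "\<tau> (Suc k) = \<tau> k + E (nat \<lceil>\<tau> k\<rceil>)" for k by (simp_all add: \<tau>_def)
  have less: "\<tau> k < \<tau> (Suc k)" for k using E(1) \<tau>S by simp
  then have mono: "mono \<tau>" by (intro mono_iff_le_Suc[THEN iffD2] allI less_imp_le)
  have nonneg: "0 \<le> \<tau> k" for k using monoD[OF mono, of 0 k] \<tau>0 by simp
  have unbounded: "\<exists>k. b \<le> \<tau> k" for b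
  proof (rule ccontr)
    assume "\<nexists>k. b \<le> \<tau> k"
    then have lt: "\<tau> k < b" for k by (simp add: not_le)
    define e where "e = Min (E ` {..nat \<lceil>b\<rceil>})"
    have "e \<in> E ` {..nat \<lceil>b\<rceil>}" unfolding e_def by (rule Min_in) auto
    then have e: "e > 0" using E(1) by auto
    have step_ge: "e \<le> E (nat \<lceil>\<tau> k\<rceil>)" for k
      unfolding e_def using lt[of k] by (intro Min_le) (auto intro!: nat_mono ceiling_mono)
    have "real k * e \<le> \<tau> k" for k
    proof (induction k)
      case (Suc k)
      then show ?case using \<tau>S[of k] step_ge[of k] by (simp add: algebra_simps)
    qed (simp add: \<tau>0)
    then have "real k * e < b" for k using lt le_less_trans by blast
    then show False using reals_Archimedean3[OF e] less_asym by blast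
  qed
  define \<sigma> where "\<sigma> = (\<lambda>k. c (\<tau> k))"
  define r where "r = (if T = \<infinity> then \<infinity> else enat (LEAST k. T \<le> ereal (\<tau> k)))"
  have mono\<sigma>: "mono \<sigma>" unfolding \<sigma>_def using mono c_mono by (simp add: mono_def)
  show thesis
  proof
    show "mono \<sigma>" by (rule mono\<sigma>)
    show "time_partition T r (\<lambda>k. ereal (\<sigma> k))"
      unfolding time_partition_def
    proof (intro conjI allI impI)
      show "ereal (\<sigma> 0) = 0" using Tc by (auto simp: \<sigma>_def \<tau>0 c_def)
    next
      fix k assume k: "enat k < r"
      show "ereal (\<sigma> k) < ereal (\<sigma> (Suc k))"
      proof (cases "T = \<infinity>")
        case True
        then show ?thesis using less by (simp add: \<sigma>_def c_def)
      next
        case False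
        then have "\<not> T \<le> ereal (\<tau> k)" using k not_less_Least by (auto simp: r_def)
        then show ?thesis using False Tc less[of k] by (auto simp: \<sigma>_def c_def)
      qed
    next
      fix k assume k: "r \<le> enat k"
      then obtain b where b: "T = ereal b" using Tc by (auto simp: r_def)
      then have le: "(LEAST k. T \<le> ereal (\<tau> k)) \<le> k" using k by (simp add: r_def)
      have "\<exists>k. T \<le> ereal (\<tau> k)" using unbounded[of b] by (simp add: b)
      then have "T \<le> ereal (\<tau> (LEAST k. T \<le> ereal (\<tau> k)))" by (rule LeastI_ex)
      also have "\<dots> \<le> ereal (\<tau> k)" using monoD[OF mono le] by simp
      finally show "ereal (\<sigma> k) = T" by (simp add: \<sigma>_def c_def b)
    next
      assume "r = \<infinity>"
      then have inf: "T = \<infinity>" by (auto simp: r_def split: if_splits)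
      have "\<exists>N. \<forall>k\<ge>N. ereal b \<le> ereal (\<sigma> k)" for b
      proof -
        obtain N where "b \<le> \<tau> N" using unbounded by blast
        then have "b \<le> \<tau> k" if "k \<ge> N" for k using monoD[OF mono that] by simp
        then show ?thesis using inf by (auto simp: \<sigma>_def c_def)
      qed
      then show "(\<lambda>k. ereal (\<sigma> k)) \<longlonglongrightarrow> T" unfolding inf Lim_PInfty by blast
    qed
    show "R (\<sigma> k) t" if t: "\<sigma> k \<le> t" "t \<le> \<sigma> (Suc k)" for k t
    proof -
      have "0 \<le> \<sigma> k" using cI[OF nonneg] by (simp add: \<sigma>_def time_interval_def)
      moreover have "ereal (\<sigma> (Suc k)) \<le> T"
        using cI[OF nonneg[of "Suc k"]] by (simp add: \<sigma>_def time_interval_def)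
      then have "ereal t \<le> T" by (rule order_trans[rotated]) (simp add: t(2))
      ultimately have tI: "t \<in> time_interval T" using t(1) by (simp add: time_interval_def)
      \<comment> \<open>If \<open>T\<close> was passed before the \<open>k\<close>-th step, then \<open>t = T < \<tau> k\<close>, and \<open>t\<close> is represented by the time \<open>\<tau> k\<close>.\<close>
      have ct: "c (max t (\<tau> k)) = t"
      proof (cases "\<tau> k \<le> t")
        case True
        then show ?thesis using c_id[OF tI] by (simp add: max_absorb1)
      next
        case False
        then have "c t \<le> \<sigma> k" unfolding \<sigma>_def by (intro c_mono) simp
        then show ?thesis using c_id[OF tI] t(1) False by (simp add: \<sigma>_def max_absorb2)
      qed
      have "R (c (\<tau> k)) (c (max t (\<tau> k)))"
      proof (rule E(2)[OF nonneg])
        show "\<tau> k \<le> real (nat \<lceil>\<tau> k\<rceil>)" by linarith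
        have "t \<le> \<tau> (Suc k)" using t(2) c_le[of "\<tau> (Suc k)"] by (simp add: \<sigma>_def)
        then show "max t (\<tau> k) \<le> \<tau> k + E (nat \<lceil>\<tau> k\<rceil>)" using less[of k] by (simp add: \<tau>S)
      qed simp
      then show ?thesis by (simp add: ct \<sigma>_def)
    qed
    show "\<exists>k. t \<le> \<sigma> k" if "t \<in> time_interval T" for t
    proof -
      obtain k where "t \<le> \<tau> k" using unbounded by blast
      then have "t \<le> \<sigma> k" using c_mono[of t "\<tau> k"] c_id[OF that] by (simp add: \<sigma>_def)
      then show ?thesis by blast
    qed
  qed
qed

section \<open>The decomposition theorem\<close>

theorem theorem4p9:
  fixes A H V :: "('a::{t2_space, second_countable_topology}, (real ^ 'q) \<times> (real ^ 'p)) chart set"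
    and \<phi> :: "real \<Rightarrow> 'a \<Rightarrow> 'a"
    and T :: ereal
    and x :: 'a
  assumes "smooth_atlas A"
    and "foliation A snd H"
    and "foliation A fst V"
    and "complementary A H V"
    and "transversely_orientable A H"
    and "0 < T"
    and "\<And>t. t \<in> time_interval T \<Longrightarrow> diffeo A (\<phi> t)"
    and "smoothly_continuous_on A (time_interval T) \<phi>"
    and "\<phi> 0 = id"
  shows "\<exists>(r :: enat) (s :: nat \<Rightarrow> ereal) (\<eta> :: nat \<Rightarrow> real \<Rightarrow> 'a \<rightharpoonup> 'a) (\<psi> :: nat \<Rightarrow> real \<Rightarrow> 'a \<rightharpoonup> 'a).
    time_partition T r s \<and>
    (\<forall>k t. s k \<le> ereal t \<and> ereal t \<le> s (Suc k) \<longrightarrow>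
       local_diffeo A (\<eta> (Suc k) t) \<and> horizontal H (\<eta> (Suc k) t) \<and>
       local_diffeo A (\<psi> (Suc k) t) \<and> vertical V (\<psi> (Suc k) t)) \<and>
    (\<forall>k t. s k = ereal t \<longrightarrow> \<eta> (Suc k) t \<subseteq>\<^sub>m Some \<and> \<psi> (Suc k) t \<subseteq>\<^sub>m Some) \<and>
    (\<forall>t \<in> time_interval T. \<exists>U. open U \<and> x \<in> U \<and>
       (\<exists>k. s k \<le> ereal t \<and> ereal t \<le> s (Suc k)) \<and>
       (\<forall>k. s k \<le> ereal t \<and> ereal t \<le> s (Suc k) \<longrightarrow>
          (\<forall>z\<in>U. ((\<eta> (Suc k) t \<circ>\<^sub>m \<psi> (Suc k) t) \<circ>\<^sub>m foliated_chain s \<eta> \<psi> k) z = Some (\<phi> t z))))"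
proof -
  note A = assms(1)
  \<comment> \<open>Trivial steps are taken to be globally the identity: this gives the initial conditions, and for finite \<open>T\<close>
      the infinitely many steps after \<open>T\<close> is reached do not shrink the neighbourhood of \<open>x\<close>.\<close>
  define Q where "Q = (\<lambda>s t \<eta> \<psi> M. foliated_step A H V x (\<phi> s) (\<phi> t) \<eta> \<psi> M \<and>
    (s = t \<longrightarrow> \<eta> = Some \<and> \<psi> = Some \<and> M = UNIV))"
  have Q: "\<exists>\<eta> \<psi> M. Q s t \<eta> \<psi> M" if "\<exists>\<eta> \<psi> M. foliated_step A H V x (\<phi> s) (\<phi> t) \<eta> \<psi> M" for s t
    using that foliated_step_refl[OF A] unfolding Q_def by (cases "s = t") blast+
  obtain r \<sigma> where part: "time_partition T r (\<lambda>k. ereal (\<sigma> k))" and mono: "mono \<sigma>"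
    and step: "\<And>k t. \<sigma> k \<le> t \<Longrightarrow> t \<le> \<sigma> (Suc k) \<Longrightarrow>
                 \<exists>\<eta> \<psi> M. foliated_step A H V x (\<phi> (\<sigma> k)) (\<phi> t) \<eta> \<psi> M"
    and reach: "\<And>t. t \<in> time_interval T \<Longrightarrow> \<exists>k. t \<le> \<sigma> k"
    using time_partition_exists[OF assms(6) foliated_step_nearby[OF A assms(2-4) assms(8) assms(7)]] by metis
  have \<sigma>0: "\<sigma> 0 = 0" using part by (simp add: time_partition_def)
  have "\<forall>k t. \<exists>\<eta> \<psi> M. \<sigma> k \<le> t \<and> t \<le> \<sigma> (Suc k) \<longrightarrow> Q (\<sigma> k) t \<eta> \<psi> M"
    using step Q by blast
  then obtain E P M where EPM: "\<And>k t. \<sigma> k \<le> t \<Longrightarrow> t \<le> \<sigma> (Suc k) \<Longrightarrow> Q (\<sigma> k) t (E k t) (P k t) (M k t)"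
    by metis
  have fs: "foliated_step A H V x (\<phi> (\<sigma> k)) (\<phi> t) (E k t) (P k t) (M k t)"
    if "\<sigma> k \<le> t" "t \<le> \<sigma> (Suc k)" for k t using EPM[OF that] by (simp add: Q_def)
  have triv: "E k (\<sigma> k) = Some" "P k (\<sigma> k) = Some" "M k (\<sigma> k) = UNIV" for k
    using EPM[of k "\<sigma> k"] monoD[OF mono, of k "Suc k"] by (simp_all add: Q_def)
  define \<eta> where "\<eta> = (\<lambda>k. E (k - 1))"
  define \<psi> where "\<psi> = (\<lambda>k. P (k - 1))"
  have Suc_eq: "\<eta> (Suc k) = E k" "\<psi> (Suc k) = P k" for k by (simp_all add: \<eta>_def \<psi>_def)
  let ?s = "\<lambda>k. ereal (\<sigma> k)"
  have extend: "((E k t \<circ>\<^sub>m P k t) \<circ>\<^sub>m f) z = Some (\<phi> t z)"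
    if "\<sigma> k \<le> t" "t \<le> \<sigma> (Suc k)" "f z = Some (\<phi> (\<sigma> k) z)" "z \<in> M k t" for k t f z
    using fs[OF that(1,2)] that(3,4) unfolding foliated_step_def by simp
  have chain: "foliated_chain ?s \<eta> \<psi> k z = Some (\<phi> (\<sigma> k) z)"
    if "\<And>j. j < k \<Longrightarrow> z \<in> M j (\<sigma> (Suc j))" for k z
    using that
  proof (induction k)
    case 0
    then show ?case using assms(9) by (simp add: \<sigma>0)
  next
    case (Suc k)
    then show ?case
      using monoD[OF mono, of k "Suc k"] by (simp only: foliated_chain.simps Suc_eq real_of_ereal.simps)
        (intro extend, auto)
  qed
  have nbhd: "\<exists>U. open U \<and> x \<in> U \<and> (\<exists>k. ?s k \<le> ereal t \<and> ereal t \<le> ?s (Suc k)) \<and>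
     (\<forall>k. ?s k \<le> ereal t \<and> ereal t \<le> ?s (Suc k) \<longrightarrow>
        (\<forall>z\<in>U. ((\<eta> (Suc k) t \<circ>\<^sub>m \<psi> (Suc k) t) \<circ>\<^sub>m foliated_chain ?s \<eta> \<psi> k) z = Some (\<phi> t z)))"
    if t: "t \<in> time_interval T" for t
  proof -
    obtain K where K: "t \<le> \<sigma> K" using reach[OF t] by blast
    \<comment> \<open>The intersection is finite, hence open: if \<open>k > K\<close> and \<open>\<sigma> k \<le> t\<close>, then all steps from \<open>\<sigma> K\<close> to \<open>t\<close> are trivial.\<close>
    define U where "U = (\<Inter>j\<in>{..K}. M j (\<sigma> (Suc j)) \<inter>
      (if \<sigma> j \<le> t \<and> t \<le> \<sigma> (Suc j) then M j t else UNIV))"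
    have op: "open (M j t)" "x \<in> M j t" if "\<sigma> j \<le> t" "t \<le> \<sigma> (Suc j)" for j t
      using fs[OF that] by (simp_all add: foliated_step_def)
    have le: "\<sigma> i \<le> \<sigma> j" if "i \<le> j" for i j using monoD[OF mono that] .
    have "open U" unfolding U_def using op le by (intro open_INT ballI) auto
    moreover have "x \<in> U" unfolding U_def using op le by auto
    moreover have "\<exists>k. \<sigma> k \<le> t \<and> t \<le> \<sigma> (Suc k)"
    proof (cases "t \<le> \<sigma> 0")
      case True
      then show ?thesis using t le[of 0 "Suc 0"] \<sigma>0 by (intro exI[of _ 0]) (auto simp: time_interval_def)
    next
      case False
      then obtain k where "t \<le> \<sigma> (Suc k)" "\<not> t \<le> \<sigma> k"
        using ex_least_nat_less[of "\<lambda>k. t \<le> \<sigma> k", OF K] by auto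
      then show ?thesis by force
    qed
    moreover have "((\<eta> (Suc k) t \<circ>\<^sub>m \<psi> (Suc k) t) \<circ>\<^sub>m foliated_chain ?s \<eta> \<psi> k) z = Some (\<phi> t z)"
      if k: "\<sigma> k \<le> t" "t \<le> \<sigma> (Suc k)" and z: "z \<in> U" for k z
      unfolding Suc_eq
    proof (rule extend[OF k chain])
      show "z \<in> M j (\<sigma> (Suc j))" if "j < k" for j
      proof (cases "j \<le> K")
        case False
        then have "\<sigma> (Suc j) = \<sigma> j"
          using le[of K j] le[of j "Suc j"] le[of "Suc j" k] that K k by simp
        then show ?thesis by (simp add: triv)
      qed (use z in \<open>auto simp: U_def\<close>)
      show "z \<in> M k t"
      proof (cases "k \<le> K")
        case False
        then have "t = \<sigma> k" using le[of K k] K k by simp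
        then show ?thesis by (simp add: triv)
      next
        case True
        then have "z \<in> (if \<sigma> k \<le> t \<and> t \<le> \<sigma> (Suc k) then M k t else UNIV)"
          using z unfolding U_def by blast
        then show ?thesis using k by simp
      qed
    qed
    ultimately show ?thesis by auto
  qed
  have steps: "\<forall>k t. ?s k \<le> ereal t \<and> ereal t \<le> ?s (Suc k) \<longrightarrow>
      local_diffeo A (\<eta> (Suc k) t) \<and> horizontal H (\<eta> (Suc k) t) \<and>
      local_diffeo A (\<psi> (Suc k) t) \<and> vertical V (\<psi> (Suc k) t)"
    using fs unfolding foliated_step_def Suc_eq by auto
  have initial: "\<forall>k t. ?s k = ereal t \<longrightarrow> \<eta> (Suc k) t \<subseteq>\<^sub>m Some \<and> \<psi> (Suc k) t \<subseteq>\<^sub>m Some"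
    using triv by (auto simp: Suc_eq)
  show ?thesis
    by (intro exI[of _ r] exI[of _ ?s] exI[of _ \<eta>] exI[of _ \<psi>] conjI part steps initial ballI nbhd)
qed

end
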